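(* For every $\rho\in\mathbb C$ there is a homomorphism of vertex superalgebras $$\Phi_\rho:V_{\mathfrak g}\left(\tfrac52,-12\rho^2\right)\to M_{\mathfrak{hc}}(1,0,0)$$ uniquely determined by $$L_{-2}\mathds{1}\mapsto a_{-1}b+\rho a_{-2}\mathds{1}+\tfrac12c_{-\frac32}c,\qquad M_{-2}\mathds{1}\mapsto\tfrac12b_{-1}b+\rho b_{-2}\mathds{1},\qquad Q_{-\frac32}\mathds{1}\mapsto b_{-1}c+2\rho c_{-\frac32}\mathds{1},$$ where $a=a_{-1}\mathds{1}$, $b=b_{-1}\mathds{1}$, $c=c_{-\frac12}\mathds{1}$; or equivalently, by $$L(z)\mapsto{:}a(z)b(z){:}+\rho a'(z)+\tfrac12{:}c'(z)c(z){:},\qquad M(z)\mapsto\tfrac12{:}b(z)b(z){:}+\rho b'(z),\qquad Q(z)\mapsto{:}b(z)c(z){:}+2\rho c'(z).$$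
   Context: The N=1 BMS superalgebra $\mathfrak g$ is the complex Lie superalgebra with even basis $L_n,M_n$ ($n\in\mathbb Z$), $\mathbf c_1,\mathbf c_2$, odd basis $Q_r$ ($r\in\mathbb Z+\frac12$), and brackets $[L_m,L_n]=(m-n)L_{m+n}+\frac1{12}\delta_{m+n,0}(m^3-m)\mathbf c_1$, $[L_m,M_n]=(m-n)M_{m+n}+\frac1{12}\delta_{m+n,0}(m^3-m)\mathbf c_2$, $[Q_r,Q_s]=2M_{r+s}+\frac13\delta_{r+s,0}(r^2-\frac14)\mathbf c_2$, $[L_m,Q_r]=(\frac m2-r)Q_{m+r}$, $[M_m,M_n]=[M_n,Q_r]=0$, with $\mathbf c_1,\mathbf c_2$ central. Vacuum module: let $M_{\mathfrak g}(0,0,c_1,c_2)$ be induced from the one-dimensional module (spanned by $\mathbf 1$) of the subalgebra spanned by $L_n,M_n$ ($n\ge0$), $Q_r$ ($r>0$), $\mathbf c_1,\mathbf c_2$, on which $L_n,M_n,Q_r$ act as $0$ and $\mathbf c_i$ as $c_i$; $V_{\mathfrak g}(c_1,c_2)$ is its quotient by the submodule generated by $L_{-1}\mathbf 1$, with $\mathds{1}$ the image of $\mathbf 1$. It is a vertex superalgebra with vacuum $\mathds{1}$, $D=L_{-1}$, and $Y(L_{-2}\mathds{1},z)=L(z)=\sum_nL_nz^{-n-2}$, $Y(M_{-2}\mathds{1},z)=M(z)=\sum_nM_nz^{-n-2}$, $Y(Q_{-\frac32}\mathds{1},z)=Q(z)=\sum_{r\in\mathbb Z+\frac12}Q_rz^{-r-\frac32}$.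 The Heisenberg-Clifford algebra $\mathfrak{hc}$ is the Lie superalgebra with even basis $a_n,b_n$ ($n\in\mathbb Z$), $\mathbf k$, odd basis $c_r$ ($r\in\mathbb Z+\frac12$), with $[a_m,b_n]=m\delta_{m+n,0}\mathbf k$, $\{c_r,c_s\}=\delta_{r+s,0}\mathbf k$, all other brackets of basis elements zero ($\mathbf k$ central). $M_{\mathfrak{hc}}(1,0,0)$ is the module induced from the one-dimensional module of the subalgebra spanned by $a_n,b_n$ ($n\ge0$), $c_r$ ($r>0$), $\mathbf k$, on which $a_n,b_n,c_r$ act as $0$ and $\mathbf k$ acts as $1$. With $\mathds{1}=1\otimes1$, it is a vertex superalgebra with vacuum $\mathds{1}$ and $Y(a_{-1}\mathds{1},z)=a(z)=\sum_na_nz^{-n-1}$, $Y(b_{-1}\mathds{1},z)=b(z)=\sum_nb_nz^{-n-1}$, $Y(c_{-\frac12}\mathds{1},z)=c(z)=\sum_{r\in\mathbb Z+\frac12}c_rz^{-r-\frac12}$. Vertex superalgebras are taken in the standard sense (vacuum, translation operator $D$, state-field map $Y$, Jacobi identity), $\frac12\mathbb Z$-graded with even part the integer and odd part the half-integer degrees. A homomorphism $f:V_1\to V_2$ is a linear map with $f(\mathds{1}_1)=\mathds{1}_2$ and $f(Y_1(u,z)v)=Y_2(f(u),z)f(v)$. The normal order is ${:}Y(u,z_1)Y(v,z_2){:}=Y^+(u,z_1)Y(v,z_2)+(-1)^{|u||v|}Y(v,z_2)Y^-(u,z_1)$, where $Y^-(u,z)=\sum_{n\ge0}u_nz^{-n-1}$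 and $Y^+(u,z)=\sum_{n<0}u_nz^{-n-1}$. Primes denote $\frac d{dz}$. In the second form, "$L(z)\mapsto X(z)$" means that $X(z)=Y(\Phi_\rho(L_{-2}\mathds{1}),z)$ on $M_{\mathfrak{hc}}(1,0,0)$, and similarly for $M(z)$ and $Q(z)$. *)

theory Defs
  imports Complex_Main "HOL-Library.Poly_Mapping" "HOL-Library.FuncSet" "HOL.Hull"
begin

section \<open>Free associative algebras\<close>

text \<open>Words over a set of generators form a monoid under concatenation, written additively so that
  the convolution product of \<open>Poly_Mapping\<close> makes \<open>'x list \<Rightarrow>\<^sub>0 complex\<close> the free unital associative
  algebra on \<open>'x\<close>, i.e. the tensor algebra of the vector space \<open>'x \<Rightarrow>\<^sub>0 complex\<close> with basis \<open>'x\<close>.\<close>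

instantiation list :: (type) monoid_add
begin

definition zero_list :: "'a list" where "zero_list = []"

definition plus_list :: "'a list \<Rightarrow> 'a list \<Rightarrow> 'a list" where "plus_list = (@)"

instance
  by standard (simp_all add: zero_list_def plus_list_def)

end

type_synonym 'x falg = "'x list \<Rightarrow>\<^sub>0 complex"

definition const :: "complex \<Rightarrow> 'x falg" where
  "const k = Poly_Mapping.single [] k"

definition gen :: "'x \<Rightarrow> 'x falg" where
  "gen x = Poly_Mapping.single [x] 1"

text \<open>The inclusion of the vector space with basis \<open>'x\<close> into its tensor algebra.\<close>

definition incl :: "('x \<Rightarrow>\<^sub>0 complex) \<Rightarrow> 'x falg" where
  "incl v = (\<Sum>x\<in>Poly_Mapping.keys v. const (Poly_Mapping.lookup v x) * gen x)"

section \<open>Quotients by left ideals\<close>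

definition left_ideal :: "'a::ring_1 set \<Rightarrow> bool" where
  "left_ideal J \<longleftrightarrow> 0 \<in> J \<and> (\<forall>x\<in>J. \<forall>y\<in>J. x + y \<in> J) \<and> (\<forall>a. \<forall>x\<in>J. a * x \<in> J)"

lemma left_ideal_zero: "left_ideal J \<Longrightarrow> 0 \<in> J"
  by (simp add: left_ideal_def)

lemma left_ideal_add: "left_ideal J \<Longrightarrow> x \<in> J \<Longrightarrow> y \<in> J \<Longrightarrow> x + y \<in> J"
  by (simp add: left_ideal_def)

lemma left_ideal_mult: "left_ideal J \<Longrightarrow> x \<in> J \<Longrightarrow> a * x \<in> J"
  by (simp add: left_ideal_def)

lemma left_ideal_minus: "left_ideal J \<Longrightarrow> x \<in> J \<Longrightarrow> - x \<in> J"
  using left_ideal_mult[of J x "- 1"] by simp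

lemma left_ideal_diff: "left_ideal J \<Longrightarrow> x \<in> J \<Longrightarrow> y \<in> J \<Longrightarrow> x - y \<in> J"
  using left_ideal_add[of J x "- y"] left_ideal_minus[of J y] by simp

lemma left_ideal_hull: "left_ideal (left_ideal hull S)"
  by (rule hull_in) (auto simp: left_ideal_def)

text \<open>The left ideals needed below depend on parameters, so a quotient \<open>A/J\<close> cannot be a type of its
  own. We therefore use one type containing all of them: \<open>'a cyc\<close> is the product of the left modules
  \<open>A/J\<close> over all left ideals \<open>J\<close> of \<open>A\<close> (a family \<open>f\<close> of representatives is taken modulo \<open>J\<close> in the
  component \<open>J\<close>), and \<open>A/J\<close> is the factor of the product with index \<open>J\<close>. The class of \<open>a\<close> in \<open>A/J\<close>
  is \<open>coset J a\<close>; see the lemmas \<open>coset_eq_iff\<close>, \<open>coset_add\<close> and \<open>act_coset\<close>.\<close>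

quotient_type (overloaded) 'a cyc = "'a::ring_1 set \<Rightarrow> 'a" /
  "\<lambda>f g. \<forall>J. left_ideal J \<longrightarrow> f J - g J \<in> J"
proof (rule equivpI)
  show "reflp (\<lambda>f g :: 'a set \<Rightarrow> 'a. \<forall>J. left_ideal J \<longrightarrow> f J - g J \<in> J)"
    by (simp add: reflp_def left_ideal_zero)
  show "symp (\<lambda>f g :: 'a set \<Rightarrow> 'a. \<forall>J. left_ideal J \<longrightarrow> f J - g J \<in> J)"
  proof (rule sympI, intro allI impI)
    fix f g :: "'a set \<Rightarrow> 'a" and J :: "'a set"
    assume "\<forall>J. left_ideal J \<longrightarrow> f J - g J \<in> J" "left_ideal J"
    then show "g J - f J \<in> J" using left_ideal_minus[of J "f J - g J"] by simp
  qed
  show "transp (\<lambda>f g :: 'a set \<Rightarrow> 'a. \<forall>J. left_ideal J \<longrightarrow> f J - g J \<in> J)"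
  proof (rule transpI, intro allI impI)
    fix f g h :: "'a set \<Rightarrow> 'a" and J :: "'a set"
    assume "\<forall>J. left_ideal J \<longrightarrow> f J - g J \<in> J" "\<forall>J. left_ideal J \<longrightarrow> g J - h J \<in> J" "left_ideal J"
    then show "f J - h J \<in> J" using left_ideal_add[of J "f J - g J" "g J - h J"] by simp
  qed
qed

instantiation cyc :: (ring_1) ab_group_add
begin

lift_definition zero_cyc :: "'a cyc" is "\<lambda>_. 0" .

lift_definition plus_cyc :: "'a cyc \<Rightarrow> 'a cyc \<Rightarrow> 'a cyc" is "\<lambda>f g J. f J + g J"
  by (simp only: add_diff_add left_ideal_add)

lift_definition uminus_cyc :: "'a cyc \<Rightarrow> 'a cyc" is "\<lambda>f J. - f J"
  by (simp only: minus_diff_minus left_ideal_minus)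

lift_definition minus_cyc :: "'a cyc \<Rightarrow> 'a cyc \<Rightarrow> 'a cyc" is "\<lambda>f g J. f J - g J"
proof -
  fix f1 f2 g1 g2 :: "'a set \<Rightarrow> 'a" and J :: "'a set"
  assume "\<And>J. left_ideal J \<Longrightarrow> f1 J - f2 J \<in> J" "\<And>J. left_ideal J \<Longrightarrow> g1 J - g2 J \<in> J" "left_ideal J"
  then have "(f1 J - f2 J) - (g1 J - g2 J) \<in> J" by (simp only: left_ideal_diff)
  moreover have "(f1 J - f2 J) - (g1 J - g2 J) = (f1 J - g1 J) - (f2 J - g2 J)" by simp
  ultimately show "(f1 J - g1 J) - (f2 J - g2 J) \<in> J" by simp
qed

instance
  by standard (transfer; simp add: algebra_simps left_ideal_zero)+

end

lift_definition act :: "'a::ring_1 \<Rightarrow> 'a cyc \<Rightarrow> 'a cyc" is "\<lambda>a f J. a * f J"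
  by (simp only: right_diff_distrib [symmetric] left_ideal_mult)

lift_definition coset :: "'a::ring_1 set \<Rightarrow> 'a \<Rightarrow> 'a cyc" is "\<lambda>J a K. if K = J then a else 0" .

lemma coset_eq_iff: "left_ideal J \<Longrightarrow> coset J a = coset J b \<longleftrightarrow> a - b \<in> J"
  by transfer (auto simp: left_ideal_zero)

lemma coset_add: "coset J (a + b) = coset J a + coset J b"
  by transfer (auto simp: left_ideal_zero)

lemma act_coset: "act a (coset J b) = coset J (a * b)"
  by transfer (auto simp: left_ideal_zero)

lemma act_add_right: "act a (v + w) = act a v + act a w"
  by transfer (simp add: distrib_left left_ideal_zero)

lemma act_add_left: "act (a + b) v = act a v + act b v"
  by transfer (simp add: distrib_right left_ideal_zero)

lemma act_act: "act a (act b v) = act (a * b) v"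
  by transfer (simp add: mult.assoc left_ideal_zero)

lemma act_one: "act 1 v = v"
  by transfer (simp add: left_ideal_zero)

definition quot_module :: "'a::ring_1 set \<Rightarrow> 'a cyc set" where
  "quot_module J = range (coset J)"

definition cscale :: "complex \<Rightarrow> 'x falg cyc \<Rightarrow> 'x falg cyc" where
  "cscale k = act (const k)"

lemma const_add: "const (a + b) = const a + const b"
  by (simp add: const_def Poly_Mapping.single_add)

lemma const_mult: "const a * const b = const (a * b)"
  by (simp add: const_def Poly_Mapping.mult_single plus_list_def)

lemma const_1: "const 1 = 1"
  by (metis const_def zero_list_def single_one)

interpretation cscale: vector_space cscale
  by standard (simp_all add: cscale_def act_add_right act_add_left act_act act_one const_add
      const_mult const_1)

section \<open>Modules induced from one-dimensional modules\<close>

text \<open>A Lie superalgebra is given by a basis \<open>'x\<close>, the parities \<open>par x \<in> {0, 1}\<close> of the basis elements,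
  and the brackets \<open>br x y\<close> of basis elements.\<close>

definition env_rel :: "('x \<Rightarrow> nat) \<Rightarrow> ('x \<Rightarrow> 'x \<Rightarrow> ('x \<Rightarrow>\<^sub>0 complex)) \<Rightarrow> 'x \<Rightarrow> 'x \<Rightarrow> 'x falg" where
  "env_rel par br x y =
     gen x * gen y - (- 1) ^ (par x * par y) * (gen y * gen x) - incl (br x y)"

text \<open>Let \<open>U\<close> be the universal enveloping algebra, i.e. the tensor algebra modulo the two-sided ideal
  generated by the elements \<open>env_rel par br x y\<close>, and let the subalgebra spanned by \<open>P\<close> act on the
  one-dimensional module through the character \<open>\<chi>\<close>. The induced module is the tensor product of
  \<open>U\<close> with this module over the enveloping algebra of the subalgebra, i.e. \<open>U\<close> modulo
  the left ideal generated by \<open>x - \<chi> x\<close> for \<open>x \<in> P\<close>. Hence it is the tensor algebra modulo the following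
  left ideal, the class of \<open>1\<close> being the generating vector.\<close>

definition induced_ideal ::
  "('x \<Rightarrow> nat) \<Rightarrow> ('x \<Rightarrow> 'x \<Rightarrow> ('x \<Rightarrow>\<^sub>0 complex)) \<Rightarrow> 'x set \<Rightarrow> ('x \<Rightarrow> complex) \<Rightarrow> 'x falg set" where
  "induced_ideal par br P \<chi> = left_ideal hull
     ({env_rel par br x y * v |x y v. True} \<union> {gen x - const (\<chi> x) |x. x \<in> P})"

text \<open>If each generator \<open>x\<close> has degree \<open>wt x\<close>, then \<open>quot_grading wt J d\<close> is the subspace of
  degree \<open>d\<close> of the quotient by \<open>J\<close>: the span of the classes of words of total degree \<open>d\<close>.\<close>

definition quot_grading :: "('x \<Rightarrow> rat) \<Rightarrow> 'x falg set \<Rightarrow> rat \<Rightarrow> 'x falg cyc set" where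
  "quot_grading wt J d =
     coset J ` {u. \<forall>w\<in>Poly_Mapping.keys u. sum_list (map wt w) = d}"

section \<open>Vertex superalgebras\<close>

definition linear_map_on ::
  "(complex \<Rightarrow> 'v::ab_group_add \<Rightarrow> 'v) \<Rightarrow> 'v set \<Rightarrow> (complex \<Rightarrow> 'w::ab_group_add \<Rightarrow> 'w) \<Rightarrow> 'w set
     \<Rightarrow> ('v \<Rightarrow> 'w) \<Rightarrow> bool" where
  "linear_map_on s V t W f \<longleftrightarrow>
     f \<in> V \<rightarrow> W \<and> (\<forall>u\<in>V. \<forall>v\<in>V. f (u + v) = f u + f v) \<and> (\<forall>k. \<forall>v\<in>V. f (s k v) = t k (f v))"

text \<open>The parity of a homogeneous vector of degree \<open>d \<in> \<half>\<int>\<close>.\<close>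

definition parity_of_degree :: "rat \<Rightarrow> nat" where
  "parity_of_degree d = (if d \<in> \<int> then 0 else 1)"

text \<open>The underlying space is the subspace \<open>V\<close>, graded by \<open>gr\<close>; \<open>Y u n v\<close> is \<open>u\<^sub>n v\<close>, the coefficient of
  \<open>z\<^bsup>-n-1\<^esup>\<close> in \<open>Y(u,z)v\<close>. The axiom \<open>jacobi\<close> is the coefficient of
  \<open>z\<^sub>0\<^bsup>-l-1\<^esup> z\<^sub>1\<^bsup>-m-1\<^esup> z\<^sub>2\<^bsup>-n-1\<^esup>\<close> in the Jacobi identity
  \<open>z\<^sub>0\<^bsup>-1\<^esup>\<delta>((z\<^sub>1-z\<^sub>2)/z\<^sub>0) Y(u,z\<^sub>1)Y(v,z\<^sub>2)w - (-1)\<^bsup>|u||v|\<^esup> z\<^sub>0\<^bsup>-1\<^esup>\<delta>((z\<^sub>2-z\<^sub>1)/(-z\<^sub>0)) Y(v,z\<^sub>2)Y(u,z\<^sub>1)w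
    = z\<^sub>2\<^bsup>-1\<^esup>\<delta>((z\<^sub>1-z\<^sub>0)/z\<^sub>2) Y(Y(u,z\<^sub>0)v,z\<^sub>2)w\<close>,
  where \<open>\<delta>(x)\<close> is the sum of all integer powers of \<open>x\<close> and powers of a binomial are expanded in
  nonnegative powers of its second summand. \<open>Sum_any\<close> sums over the finite
  support of a function; the supports below are finite by \<open>truncation\<close>.\<close>

locale vertex_superalgebra = vector_space scale
  for scale :: "complex \<Rightarrow> 'v::ab_group_add \<Rightarrow> 'v" +
  fixes V :: "'v set"
    and gr :: "rat \<Rightarrow> 'v set"
    and vac :: 'v
    and D :: "'v \<Rightarrow> 'v"
    and Y :: "'v \<Rightarrow> int \<Rightarrow> 'v \<Rightarrow> 'v"
  assumes subspace_V: "subspace V"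
    and subspace_gr: "subspace (gr d)"
    and gr_subset: "gr d \<subseteq> V"
    and gr_half_integral: "2 * d \<notin> \<int> \<Longrightarrow> gr d = {0}"
    and gr_decomposition:
      "v \<in> V \<Longrightarrow> \<exists>!f. (\<forall>d. f d \<in> gr d) \<and> finite {d. f d \<noteq> 0} \<and> v = Sum_any f"
    and vac_degree: "vac \<in> gr 0"
    and linear_D: "linear_map_on scale V scale V D"
    and linear_Y_left: "v \<in> V \<Longrightarrow> linear_map_on scale V scale V (\<lambda>u. Y u n v)"
    and linear_Y_right: "u \<in> V \<Longrightarrow> linear_map_on scale V scale V (\<lambda>v. Y u n v)"
    and Y_degree: "u \<in> gr d \<Longrightarrow> v \<in> gr e \<Longrightarrow> Y u n v \<in> gr (d + e - of_int n - 1)"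
    and truncation: "u \<in> V \<Longrightarrow> v \<in> V \<Longrightarrow> \<exists>N. \<forall>n\<ge>N. Y u n v = 0"
    and vacuum: "v \<in> V \<Longrightarrow> Y vac n v = (if n = - 1 then v else 0)"
    and creation: "u \<in> V \<Longrightarrow> n \<ge> 0 \<Longrightarrow> Y u n vac = 0"
      "u \<in> V \<Longrightarrow> Y u (- 1) vac = u"
    and translation:
      "u \<in> V \<Longrightarrow> v \<in> V \<Longrightarrow> Y (D u) n v = scale (- of_int n) (Y u (n - 1) v)"
      "u \<in> V \<Longrightarrow> v \<in> V \<Longrightarrow> D (Y u n v) - Y u n (D v) = scale (- of_int n) (Y u (n - 1) v)"
    and jacobi: "u \<in> gr d \<Longrightarrow> v \<in> gr e \<Longrightarrow> w \<in> V \<Longrightarrow>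
      Sum_any (\<lambda>i::nat. scale ((- 1) ^ i * (of_int l gchoose i))
          (Y u (m + l - int i) (Y v (n + int i) w)))
      - scale ((- 1) ^ (parity_of_degree d * parity_of_degree e)) (Sum_any (\<lambda>i::nat.
          scale ((- 1) powi l * (- 1) ^ i * (of_int l gchoose i))
            (Y v (n + l - int i) (Y u (m + int i) w))))
      = Sum_any (\<lambda>i::nat. scale (of_int m gchoose i) (Y (Y u (l + int i) v) (m + n - int i) w))"

definition vertex_hom ::
  "(complex \<Rightarrow> 'v::ab_group_add \<Rightarrow> 'v) \<Rightarrow> 'v set \<Rightarrow> 'v \<Rightarrow> ('v \<Rightarrow> int \<Rightarrow> 'v \<Rightarrow> 'v) \<Rightarrow>
   (complex \<Rightarrow> 'w::ab_group_add \<Rightarrow> 'w) \<Rightarrow> 'w set \<Rightarrow> 'w \<Rightarrow> ('w \<Rightarrow> int \<Rightarrow> 'w \<Rightarrow> 'w) \<Rightarrow>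
   ('v \<Rightarrow> 'w) \<Rightarrow> bool" where
  "vertex_hom s1 V1 vac1 Y1 s2 V2 vac2 Y2 f \<longleftrightarrow>
     linear_map_on s1 V1 s2 V2 f \<and> f vac1 = vac2 \<and>
     (\<forall>u\<in>V1. \<forall>v\<in>V1. \<forall>n. f (Y1 u n v) = Y2 (f u) n (f v))"

text \<open>A formal series \<open>A(z) = \<Sum>\<^sub>n A\<^sub>n z\<^bsup>-n-1\<^esup>\<close> of operators is represented by \<open>n \<mapsto> A\<^sub>n\<close>. In the normally
  ordered product, \<open>p\<close> and \<open>q\<close> are the parities of \<open>A\<close> and \<open>B\<close>; the first sum runs over the modes
  \<open>A\<^sub>j\<close> with \<open>j = - i - 1 < 0\<close>, the second one over those with \<open>j = i \<ge> 0\<close>.\<close>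

definition field_deriv :: "(int \<Rightarrow> 'x falg cyc \<Rightarrow> 'x falg cyc) \<Rightarrow> int \<Rightarrow> 'x falg cyc \<Rightarrow> 'x falg cyc" where
  "field_deriv A n w = cscale (- of_int n) (A (n - 1) w)"

definition normal_product ::
  "nat \<Rightarrow> (int \<Rightarrow> 'x falg cyc \<Rightarrow> 'x falg cyc) \<Rightarrow> nat \<Rightarrow> (int \<Rightarrow> 'x falg cyc \<Rightarrow> 'x falg cyc) \<Rightarrow>
   int \<Rightarrow> 'x falg cyc \<Rightarrow> 'x falg cyc" where
  "normal_product p A q B n w =
     Sum_any (\<lambda>i::nat. A (- int i - 1) (B (n + int i) w))
     + cscale ((- 1) ^ (p * q)) (Sum_any (\<lambda>i::nat. B (n - 1 - int i) (A (int i) w)))"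

section \<open>The N=1 BMS superalgebra and its vacuum module\<close>

text \<open>Half-integers are encoded by integers: \<open>QB k\<close> stands for \<open>Q\<^sub>r\<close> with \<open>r = k + 1/2\<close>.\<close>

datatype bms = LB int | MB int | QB int | C1B | C2B

definition half :: "int \<Rightarrow> 'a::field_char_0" where
  "half k = of_int k + 1 / 2"

fun bms_par :: "bms \<Rightarrow> nat" where
  "bms_par (QB k) = 1"
| "bms_par _ = 0"

fun bms_wt :: "bms \<Rightarrow> rat" where
  "bms_wt (LB n) = - of_int n"
| "bms_wt (MB n) = - of_int n"
| "bms_wt (QB k) = - half k"
| "bms_wt C1B = 0"
| "bms_wt C2B = 0"

text \<open>The value of \<open>vir X C m n\<close> is \<open>(m-n) X\<^sub>m\<^sub>+\<^sub>n + (1/12) \<delta>\<^sub>m\<^sub>+\<^sub>n\<^sub>,\<^sub>0 (m\<^sup>3-m) C\<close>.\<close>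

definition vir :: "(int \<Rightarrow> bms) \<Rightarrow> bms \<Rightarrow> int \<Rightarrow> int \<Rightarrow> (bms \<Rightarrow>\<^sub>0 complex)" where
  "vir X C m n = Poly_Mapping.single (X (m + n)) (of_int (m - n))
     + (if m + n = 0 then Poly_Mapping.single C (of_int (m ^ 3 - m) / 12) else 0)"

definition bms_LQ :: "int \<Rightarrow> int \<Rightarrow> (bms \<Rightarrow>\<^sub>0 complex)" where
  "bms_LQ m k = Poly_Mapping.single (QB (m + k)) (of_int m / 2 - half k)"

text \<open>With \<open>r = k + 1/2\<close> and \<open>s = l + 1/2\<close> one has \<open>r + s = k + l + 1\<close>.\<close>

fun bms_br :: "bms \<Rightarrow> bms \<Rightarrow> (bms \<Rightarrow>\<^sub>0 complex)" where
  "bms_br (LB m) (LB n) = vir LB C1B m n"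
| "bms_br (LB m) (MB n) = vir MB C2B m n"
| "bms_br (MB n) (LB m) = - vir MB C2B m n"
| "bms_br (QB k) (QB l) = Poly_Mapping.single (MB (k + l + 1)) 2
     + (if k + l + 1 = 0 then Poly_Mapping.single C2B (((half k)\<^sup>2 - 1 / 4) / 3) else 0)"
| "bms_br (LB m) (QB k) = bms_LQ m k"
| "bms_br (QB k) (LB m) = - bms_LQ m k"
| "bms_br _ _ = 0"

definition bms_nonneg :: "bms set" where
  "bms_nonneg = LB ` {0..} \<union> MB ` {0..} \<union> QB ` {k. half k > (0::rat)} \<union> {C1B, C2B}"

fun bms_char :: "complex \<Rightarrow> complex \<Rightarrow> bms \<Rightarrow> complex" where
  "bms_char c1 c2 C1B = c1"
| "bms_char c1 c2 C2B = c2"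
| "bms_char c1 c2 _ = 0"

text \<open>\<open>vac_ideal c1 c2\<close> is the preimage in the tensor algebra of the submodule of
  \<open>M\<^sub>\<gg>(0,0,c1,c2)\<close> generated by \<open>L\<^sub>-\<^sub>1\<one>\<close>.\<close>

definition vac_ideal :: "complex \<Rightarrow> complex \<Rightarrow> bms falg set" where
  "vac_ideal c1 c2 = left_ideal hull
     (induced_ideal bms_par bms_br bms_nonneg (bms_char c1 c2) \<union> {gen (LB (- 1))})"

definition V_bms :: "complex \<Rightarrow> complex \<Rightarrow> bms falg cyc set" where
  "V_bms c1 c2 = quot_module (vac_ideal c1 c2)"

definition vac_bms :: "complex \<Rightarrow> complex \<Rightarrow> bms falg cyc" where
  "vac_bms c1 c2 = coset (vac_ideal c1 c2) 1"

definition L_op :: "int \<Rightarrow> bms falg cyc \<Rightarrow> bms falg cyc" where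
  "L_op n = act (gen (LB n))"

definition M_op :: "int \<Rightarrow> bms falg cyc \<Rightarrow> bms falg cyc" where
  "M_op n = act (gen (MB n))"

definition Q_op :: "int \<Rightarrow> bms falg cyc \<Rightarrow> bms falg cyc" where
  "Q_op k = act (gen (QB k))"

text \<open>In \<open>Q(z)\<close> the coefficient of \<open>z\<^bsup>-n-1\<^esup>\<close> is \<open>Q\<^sub>r\<close> with \<open>r = n - 1/2 = (n - 1) + 1/2\<close>, and
  \<open>Q\<^bsub>-3/2\<^esub>\<close> is \<open>Q_op (-2)\<close>.\<close>

definition bms_vertex_superalgebra ::
  "complex \<Rightarrow> complex \<Rightarrow> (bms falg cyc \<Rightarrow> int \<Rightarrow> bms falg cyc \<Rightarrow> bms falg cyc) \<Rightarrow> bool" where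
  "bms_vertex_superalgebra c1 c2 Y \<longleftrightarrow>
     vertex_superalgebra cscale (V_bms c1 c2) (quot_grading bms_wt (vac_ideal c1 c2))
       (vac_bms c1 c2) (L_op (- 1)) Y \<and>
     (\<forall>n. \<forall>v\<in>V_bms c1 c2.
        Y (L_op (- 2) (vac_bms c1 c2)) n v = L_op (n - 1) v \<and>
        Y (M_op (- 2) (vac_bms c1 c2)) n v = M_op (n - 1) v \<and>
        Y (Q_op (- 2) (vac_bms c1 c2)) n v = Q_op (n - 1) v)"

section \<open>The Heisenberg-Clifford algebra and its vacuum module\<close>

text \<open>Again \<open>CH k\<close> stands for \<open>c\<^sub>r\<close> with \<open>r = k + 1/2\<close>.\<close>

datatype hc = AH int | BH int | CH int | KH

fun hc_par :: "hc \<Rightarrow> nat" where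
  "hc_par (CH k) = 1"
| "hc_par _ = 0"

fun hc_wt :: "hc \<Rightarrow> rat" where
  "hc_wt (AH n) = - of_int n"
| "hc_wt (BH n) = - of_int n"
| "hc_wt (CH k) = - half k"
| "hc_wt KH = 0"

definition hc_AB :: "int \<Rightarrow> int \<Rightarrow> (hc \<Rightarrow>\<^sub>0 complex)" where
  "hc_AB m n = (if m + n = 0 then Poly_Mapping.single KH (of_int m) else 0)"

fun hc_br :: "hc \<Rightarrow> hc \<Rightarrow> (hc \<Rightarrow>\<^sub>0 complex)" where
  "hc_br (AH m) (BH n) = hc_AB m n"
| "hc_br (BH n) (AH m) = - hc_AB m n"
| "hc_br (CH k) (CH l) = (if k + l + 1 = 0 then Poly_Mapping.single KH 1 else 0)"
| "hc_br _ _ = 0"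

definition hc_nonneg :: "hc set" where
  "hc_nonneg = AH ` {0..} \<union> BH ` {0..} \<union> CH ` {k. half k > (0::rat)} \<union> {KH}"

fun hc_char :: "hc \<Rightarrow> complex" where
  "hc_char KH = 1"
| "hc_char _ = 0"

definition hc_ideal :: "hc falg set" where
  "hc_ideal = induced_ideal hc_par hc_br hc_nonneg hc_char"

definition M_hc :: "hc falg cyc set" where
  "M_hc = quot_module hc_ideal"

definition vac_hc :: "hc falg cyc" where
  "vac_hc = coset hc_ideal 1"

definition a_op :: "int \<Rightarrow> hc falg cyc \<Rightarrow> hc falg cyc" where
  "a_op n = act (gen (AH n))"

definition b_op :: "int \<Rightarrow> hc falg cyc \<Rightarrow> hc falg cyc" where
  "b_op n = act (gen (BH n))"

text \<open>In \<open>c(z)\<close> the coefficient of \<open>z\<^bsup>-n-1\<^esup>\<close> is \<open>c\<^sub>r\<close> with \<open>r = n + 1/2\<close>, i.e. \<open>c_op n\<close>; so the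
  families \<open>a_op\<close>, \<open>b_op\<close>, \<open>c_op\<close> also represent the series \<open>a(z)\<close>, \<open>b(z)\<close>, \<open>c(z)\<close>. Moreover
  \<open>c\<^bsub>-1/2\<^esub>\<close> is \<open>c_op (-1)\<close> and \<open>c\<^bsub>-3/2\<^esub>\<close> is \<open>c_op (-2)\<close>.\<close>

definition c_op :: "int \<Rightarrow> hc falg cyc \<Rightarrow> hc falg cyc" where
  "c_op k = act (gen (CH k))"

definition hc_vertex_superalgebra ::
  "(hc falg cyc \<Rightarrow> hc falg cyc) \<Rightarrow> (hc falg cyc \<Rightarrow> int \<Rightarrow> hc falg cyc \<Rightarrow> hc falg cyc) \<Rightarrow> bool" where
  "hc_vertex_superalgebra D Y \<longleftrightarrow>
     vertex_superalgebra cscale M_hc (quot_grading hc_wt hc_ideal) vac_hc D Y \<and>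
     (\<forall>n. \<forall>v\<in>M_hc.
        Y (a_op (- 1) vac_hc) n v = a_op n v \<and>
        Y (b_op (- 1) vac_hc) n v = b_op n v \<and>
        Y (c_op (- 1) vac_hc) n v = c_op n v)"

end

theory Submission
  imports Defs
begin

text \<open>Let \<open>\<omega>L\<close>, \<open>\<omega>M\<close>, \<open>\<omega>Q\<close> be the prescribed images of the three generating states. By the commutator
  formula the brackets of their modes depend only on the products \<open>u\<^sub>i v\<close> (\<open>i \<ge> 0\<close>) of these states, which
  are found by moving modes of \<open>a\<close>, \<open>b\<close>, \<open>c\<close> to the vacuum; the result is that the modes satisfy the BMS
  relations with \<open>c\<^sub>1 = 5/2\<close>, \<open>c\<^sub>2 = -12\<rho>\<^sup>2\<close> and that the nonnegative ones kill the vacuum. Hence the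
  vacuum module maps to \<open>M_hc\<close>. This map commutes with the modes of the generating states by
  construction, and the iterate formula (the Jacobi identity with \<open>m = 0\<close>) extends this to all states,
  one mode at a time. The two descriptions of the map agree because \<open>Y(u\<^sub>-\<^sub>1 v, z)\<close> is the normally
  ordered product, and because a state is recovered from its field by acting on the vacuum.\<close>

section \<open>Modes in a vertex superalgebra\<close>

lemma gbinomial_0_left: "(0 :: complex) gchoose i = (if i = 0 then 1 else 0)"
  by (cases i) simp_all

lemma gbinomial_minus_one: "(- 1 :: complex) gchoose i = (- 1) ^ i"
  using gbinomial_minus [of "1 :: complex" i] binomial_gbinomial [of i i, where 'a = complex] by simp

lemma Sum_any_nat_bounded:
  fixes g :: "nat \<Rightarrow> 'a::comm_monoid_add"
  assumes "\<And>i. i \<ge> N \<Longrightarrow> g i = 0"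
  shows "Sum_any g = sum g {..<N}"
  by (rule Sum_any.expand_superset) (use assms in \<open>auto simp: not_less [symmetric]\<close>)

lemma linear_map_onD:
  assumes "linear_map_on s V t W f"
  shows "u \<in> V \<Longrightarrow> f u \<in> W"
    and "u \<in> V \<Longrightarrow> v \<in> V \<Longrightarrow> f (u + v) = f u + f v"
    and "v \<in> V \<Longrightarrow> f (s k v) = t k (f v)"
  using assms by (auto simp: linear_map_on_def)

lemma linear_map_on_0:
  assumes f: "linear_map_on s V t W f" and "0 \<in> V"
  shows "f 0 = 0"
  using linear_map_onD(2) [OF f, of 0 0] \<open>0 \<in> V\<close> by simp

lemma linear_map_on_Sum_any:
  fixes f :: "'a::ab_group_add \<Rightarrow> 'b::ab_group_add"
  assumes f: "linear_map_on s V t W f" and V: "0 \<in> V" "\<And>x y. x \<in> V \<Longrightarrow> y \<in> V \<Longrightarrow> x + y \<in> V"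
    and fin: "finite {i. g i \<noteq> 0}" and g: "\<And>i. g i \<in> V"
  shows "f (Sum_any g) = Sum_any (\<lambda>i. f (g i))"
proof -
  have f0: "f 0 = 0" using linear_map_on_0 [OF f V(1)] .
  have "f (sum g S) = (\<Sum>i\<in>S. f (g i)) \<and> sum g S \<in> V" if "finite S" for S
    using that
    by (induction S) (auto simp: f0 V g linear_map_onD(2) [OF f])
  moreover have "Sum_any (\<lambda>i. f (g i)) = (\<Sum>i\<in>{i. g i \<noteq> 0}. f (g i))"
    by (rule Sum_any.expand_superset) (use fin f0 in auto)
  ultimately show ?thesis using fin by (simp add: Sum_any.expand_set)
qed

text \<open>The sign of the Jacobi identity is kept opaque, to be evaluated by the table
  \<open>koszul_simps\<close> for the few degrees that occur.\<close>

definition koszul :: "rat \<Rightarrow> rat \<Rightarrow> complex" where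
  "koszul d e = (- 1) ^ (parity_of_degree d * parity_of_degree e)"

section \<open>Closure properties and special cases of the Jacobi identity\<close>

context vertex_superalgebra
begin

lemma gr_in_V: "v \<in> gr d \<Longrightarrow> v \<in> V"
  using gr_subset by blast

lemma vac_in_V: "vac \<in> V"
  using vac_degree by (rule gr_in_V)

lemma Y_in_V: "u \<in> V \<Longrightarrow> v \<in> V \<Longrightarrow> Y u n v \<in> V"
  using linear_map_onD(1) [OF linear_Y_right] .

lemma D_in_V: "v \<in> V \<Longrightarrow> D v \<in> V"
  using linear_map_onD(1) [OF linear_D] .

lemmas Y_add_left = linear_map_onD(2) [OF linear_Y_left]
  and Y_scale_left = linear_map_onD(3) [OF linear_Y_left]
  and Y_add_right = linear_map_onD(2) [OF linear_Y_right]
  and Y_scale_right = linear_map_onD(3) [OF linear_Y_right]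

lemma zero_in_V: "0 \<in> V"
  using subspace_V by (rule subspace_0)

lemma add_in_V: "u \<in> V \<Longrightarrow> v \<in> V \<Longrightarrow> u + v \<in> V"
  using subspace_V by (rule subspace_add)

lemma scale_in_V: "v \<in> V \<Longrightarrow> scale k v \<in> V"
  using subspace_V by (rule subspace_scale)

lemma Y_zero_left: "v \<in> V \<Longrightarrow> Y 0 n v = 0"
  using linear_map_on_0 [OF linear_Y_left zero_in_V] .

lemma Y_minus_left: "u \<in> V \<Longrightarrow> v \<in> V \<Longrightarrow> Y (- u) n v = - Y u n v"
  using Y_scale_left [of v u "- 1" n] by simp

lemma Y_zero_right: "u \<in> V \<Longrightarrow> Y u n 0 = 0"
  using linear_map_on_0 [OF linear_Y_right zero_in_V] .

text \<open>By creation \<open>D vac\<close> is its own mode -1 on the vacuum, and translation turns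
  this into mode -2 of the vacuum field, which is zero.\<close>

lemma D_vac: "D vac = 0"
proof -
  have "D vac = Y (D vac) (- 1) vac"
    using D_in_V vac_in_V by (simp add: creation)
  also have "\<dots> = 0"
    using translation(1) [of vac vac "- 1"] vacuum [of vac "- 2"] by (simp add: vac_in_V)
  finally show ?thesis .
qed

lemma Y_D: "u \<in> V \<Longrightarrow> v \<in> V \<Longrightarrow> Y (D u) n v = scale (- of_int n) (Y u (n - 1) v)"
  by (rule translation(1))

text \<open>This is the Jacobi identity with \<open>l = 0\<close>: only the term
  \<open>i = 0\<close> survives in each sum on the left.\<close>

lemma commutator:
  assumes u: "u \<in> gr d" and v: "v \<in> gr e" and w: "w \<in> V"
  shows "Y u m (Y v n w) - scale (koszul d e) (Y v n (Y u m w))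
    = Sum_any (\<lambda>i::nat. scale (of_int m gchoose i) (Y (Y u (int i) v) (m + n - int i) w))"
proof -
  have "Sum_any (\<lambda>i::nat. scale ((- 1) ^ i * (of_int 0 gchoose i)) (Y u (m - int i) (Y v (n + int i) w)))
      = Y u m (Y v n w)"
    by (subst Sum_any_nat_bounded [of 1]) (simp_all add: gbinomial_0_left)
  moreover have "Sum_any (\<lambda>i::nat. scale ((- 1) powi 0 * (- 1) ^ i * (of_int 0 gchoose i))
      (Y v (n - int i) (Y u (m + int i) w))) = Y v n (Y u m w)"
    by (subst Sum_any_nat_bounded [of 1]) (simp_all add: gbinomial_0_left)
  ultimately show ?thesis
    using jacobi [OF u v w, of 0 m n] by (simp add: koszul_def)
qed

lemma iterate:
  assumes u: "u \<in> gr d" and v: "v \<in> gr e" and w: "w \<in> V"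
  shows "Y (Y u l v) n w =
      Sum_any (\<lambda>i::nat. scale ((- 1) ^ i * (of_int l gchoose i)) (Y u (l - int i) (Y v (n + int i) w)))
      - scale (koszul d e) (Sum_any (\<lambda>i::nat.
          scale ((- 1) powi l * (- 1) ^ i * (of_int l gchoose i)) (Y v (n + l - int i) (Y u (int i) w))))"
proof -
  have "Sum_any (\<lambda>i::nat. scale (of_int 0 gchoose i) (Y (Y u (l + int i) v) (n - int i) w)) = Y (Y u l v) n w"
    by (subst Sum_any_nat_bounded [of 1]) (simp_all add: gbinomial_0_left)
  then show ?thesis
    using jacobi [OF u v w, of l 0 n] by (simp add: koszul_def)
qed

text \<open>Put \<open>l = -1\<close> in \<open>iterate\<close>: the binomial coefficient cancels
  the alternating sign, and the factor \<open>(-1) powi l\<close> turns the difference into a sum.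
  The right side has the shape of \<open>normal_product\<close>.\<close>

lemma Y_minus_one_product:
  assumes u: "u \<in> gr d" and v: "v \<in> gr e" and w: "w \<in> V"
  shows "Y (Y u (- 1) v) n w =
      Sum_any (\<lambda>i::nat. Y u (- int i - 1) (Y v (n + int i) w))
      + scale (koszul d e) (Sum_any (\<lambda>i::nat. Y v (n - 1 - int i) (Y u (int i) w)))"
proof -
  have sgn: "(- 1) ^ i * (of_int (- 1) gchoose i) = (1 :: complex)" for i
    by (simp add: gbinomial_minus_one flip: power_mult_distrib)
  have sgn': "(- 1) powi (- 1) * (- 1) ^ i * (of_int (- 1) gchoose i) = (- 1 :: complex)" for i
    by (simp add: gbinomial_minus_one power_int_minus flip: power_mult_distrib)
  have neg: "Sum_any (\<lambda>i::nat. scale (- 1) (Y v (n + - 1 - int i) (Y u (int i) w)))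
      = - Sum_any (\<lambda>i::nat. Y v (n - 1 - int i) (Y u (int i) w))"
    by (simp add: Sum_any.expand_set sum_negf)
  have shift: "- 1 - int i = - int i - 1" for i
    by simp
  show ?thesis
    unfolding iterate [OF u v w, of "- 1" n] sgn sgn' neg shift by simp
qed

text \<open>All brackets below come from operator products with a pole of order at most four, so the
  commutator formula has four terms.\<close>

lemma commutator_fourth_order_pole:
  assumes u: "u \<in> gr d" and v: "v \<in> gr e" and w: "w \<in> V"
    and p: "Y u 0 v = p0" "Y u 1 v = p1" "Y u 2 v = p2" "Y u 3 v = p3"
    and vanish: "\<And>i. i \<ge> 4 \<Longrightarrow> Y u i v = 0"
  shows "Y u m (Y v n w) - scale (koszul d e) (Y v n (Y u m w))
    = Y p0 (m + n) w + scale (of_int m) (Y p1 (m + n - 1) w)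
      + scale (of_int m * (of_int m - 1) / 2) (Y p2 (m + n - 2) w)
      + scale (of_int m * (of_int m - 1) * (of_int m - 2) / 6) (Y p3 (m + n - 3) w)"
proof -
  have binom: "(x gchoose 2) = x * (x - 1) / 2" "(x gchoose 3) = x * (x - 1) * (x - 2) / 6" for x :: complex
    by (simp_all add: gbinomial_prod_rev numeral_eq_Suc prod.atLeast0_lessThan_Suc)
  have "{..<4} = {0, 1, 2, 3 :: nat}" by auto
  then show ?thesis
    unfolding commutator [OF u v w]
    by (subst Sum_any_nat_bounded [of 4])
       (use w vanish in \<open>simp_all add: p binom Y_zero_left algebra_simps\<close>)
qed

end

text \<open>Here \<open>g i\<close> stands for the outer mode together with its coefficient, so that
  truncation of the inner mode bounds the support of the sums in \<open>iterate\<close>.\<close>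

lemma (in vertex_superalgebra) finite_modes:
  assumes "u \<in> V" "v \<in> V" and g: "\<And>i. g i 0 = 0"
  shows "finite {i::nat. g i (Y u (n + int i) v) \<noteq> 0}"
proof -
  obtain N where N: "\<And>n. n \<ge> N \<Longrightarrow> Y u n v = 0"
    using truncation assms(1,2) by blast
  have "{i::nat. g i (Y u (n + int i) v) \<noteq> 0} \<subseteq> {..<nat (N - n)}"
    using N g by (auto simp: not_less [symmetric] zless_nat_eq_int_zless) (metis add.commute diff_le_eq not_le)
  then show ?thesis
    by (rule finite_subset) simp
qed

text \<open>The iterate formula writes the modes of a product through the modes of its factors, with
  coefficients that depend only on \<open>l\<close> and the degrees. Asking \<open>f\<close> to keep
  the degrees of \<open>u\<close> and \<open>v\<close> makes the Koszul signs agree on both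
  sides.\<close>

lemma intertwines_product:
  assumes A: "vertex_superalgebra s1 V1 gr1 vac1 D1 Y1"
    and B: "vertex_superalgebra s2 V2 gr2 vac2 D2 Y2"
    and f: "linear_map_on s1 V1 s2 V2 f"
    and u: "u \<in> gr1 d" "f u \<in> gr2 d" and v: "v \<in> gr1 e" "f v \<in> gr2 e"
    and fu: "\<And>n w. w \<in> V1 \<Longrightarrow> f (Y1 u n w) = Y2 (f u) n (f w)"
    and fv: "\<And>n w. w \<in> V1 \<Longrightarrow> f (Y1 v n w) = Y2 (f v) n (f w)"
    and w: "w \<in> V1"
  shows "f (Y1 (Y1 u l v) n w) = Y2 (f (Y1 u l v)) n (f w)"
proof -
  interpret A: vertex_superalgebra s1 V1 gr1 vac1 D1 Y1 by fact
  interpret B: vertex_superalgebra s2 V2 gr2 vac2 D2 Y2 by fact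
  have uV: "u \<in> V1" and vV: "v \<in> V1" using u v A.gr_in_V by auto
  note clos = A.Y_in_V A.scale_in_V uV vV w
  have fw: "f w \<in> V2" using linear_map_onD(1) [OF f w] .
  note f_sum = linear_map_on_Sum_any [OF f A.zero_in_V A.add_in_V]
  have 1: "f (Sum_any (\<lambda>i::nat. s1 (k i) (Y1 u (l - int i) (Y1 v (n + int i) w))))
      = Sum_any (\<lambda>i::nat. s2 (k i) (Y2 (f u) (l - int i) (Y2 (f v) (n + int i) (f w))))" for k
    by (subst f_sum) (use A.finite_modes [where g = "\<lambda>i x. s1 (k i) (Y1 u (l - int i) x)"]
      in \<open>simp_all add: clos A.Y_zero_right linear_map_onD(3) [OF f] fu fv\<close>)
  have 2: "f (Sum_any (\<lambda>i::nat. s1 (k i) (Y1 v (n + l - int i) (Y1 u (int i) w))))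
      = Sum_any (\<lambda>i::nat. s2 (k i) (Y2 (f v) (n + l - int i) (Y2 (f u) (int i) (f w))))" for k
    by (subst f_sum) (use A.finite_modes [where n = 0 and g = "\<lambda>i x. s1 (k i) (Y1 v (n + l - int i) x)"]
      in \<open>simp_all add: clos A.Y_zero_right linear_map_onD(3) [OF f] fu fv\<close>)
  have sum_V: "Sum_any g \<in> V1" if "\<And>i. g i \<in> V1" for g :: "nat \<Rightarrow> _"
    unfolding Sum_any.expand_set using A.subspace_V that by (simp add: A.subspace_sum)
  have diff: "f (x - s1 k y) = f x - s2 k (f y)" if "x \<in> V1" "y \<in> V1" for x y k
    using linear_map_onD(2) [OF f, of x "s1 (- k) y"] linear_map_onD(3) [OF f, of y "- k"]
      A.scale_in_V [of y "- k"] that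
    by simp
  show ?thesis
    unfolding A.iterate [OF u(1) v(1) w]
    by (subst diff)
       (simp_all add: fu vV 1 2 sum_V clos B.iterate [OF u(2) v(2) fw])
qed

section \<open>Maps out of cyclic modules of the free algebra\<close>

text \<open>The vector obtained from \<open>v\<close> by applying \<open>u\<close> in the
  representation of the free algebra in which each generator \<open>x\<close> acts by
  \<open>T x\<close>.\<close>

definition free_eval :: "(complex \<Rightarrow> 'v::ab_group_add \<Rightarrow> 'v) \<Rightarrow> ('x \<Rightarrow> 'v \<Rightarrow> 'v) \<Rightarrow> 'v \<Rightarrow> 'x falg \<Rightarrow> 'v" where
  "free_eval s T v u = (\<Sum>w\<in>Poly_Mapping.keys u. s (Poly_Mapping.lookup u w) (foldr T w v))"

lemma falg_induct [case_names zero add word]: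
  fixes u :: "'x falg"
  assumes zero: "P 0" and add: "\<And>u v. P u \<Longrightarrow> P v \<Longrightarrow> P (u + v)"
    and word: "\<And>w k. P (Poly_Mapping.single w k)"
  shows "P u"
proof -
  have "P (\<Sum>w\<in>S. Poly_Mapping.single w (Poly_Mapping.lookup u w))" if "finite S" for S
    using that by (induction S) (auto simp: assms)
  moreover have "(\<Sum>w\<in>Poly_Mapping.keys u. Poly_Mapping.single w (Poly_Mapping.lookup u w)) = u"
    by (rule poly_mapping_eqI)
       (simp add: lookup_sum lookup_single when_def in_keys_iff sum.delta)
  ultimately show ?thesis by (metis finite_keys)
qed

lemma single_Cons: "Poly_Mapping.single (x # w) k = gen x * Poly_Mapping.single w k"
  by (simp add: gen_def Poly_Mapping.mult_single plus_list_def)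

lemma single_eq_const_mult: "Poly_Mapping.single w k = const k * Poly_Mapping.single w 1"
  by (simp add: const_def Poly_Mapping.mult_single plus_list_def)

text \<open>Scalars act on \<open>cyc\<close> by left multiplication with constants, so centrality
  of the constants is what makes each \<open>act u\<close> complex linear.\<close>

lemma const_commute: "const k * u = u * const k"
  by (induction u rule: falg_induct)
     (simp_all add: const_def Poly_Mapping.mult_single plus_list_def distrib_left distrib_right mult.commute)

locale free_representation = vector_space scale
  for scale :: "complex \<Rightarrow> 'v::ab_group_add \<Rightarrow> 'v" +
  fixes W :: "'v set" and T :: "'x \<Rightarrow> 'v \<Rightarrow> 'v" and v0 :: 'v
  assumes subspace_W: "subspace W"
    and linear_T: "linear_map_on scale W scale W (T x)"
    and v0_in_W: "v0 \<in> W"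
begin

abbreviation eval :: "'x falg \<Rightarrow> 'v" where
  "eval \<equiv> free_eval scale T v0"

lemma foldr_T_in_W: "foldr T w v0 \<in> W"
  by (induction w) (simp_all add: v0_in_W linear_map_onD(1) [OF linear_T])

lemma eval_in_W: "eval u \<in> W"
  unfolding free_eval_def using subspace_W foldr_T_in_W by (simp add: subspace_sum subspace_scale)

lemma eval_zero: "eval 0 = 0"
  by (simp add: free_eval_def)

lemma eval_add: "eval (u + v) = eval u + eval v"
  unfolding free_eval_def by (rule setsum_keys_plus_distrib) (simp_all add: scale_left_distrib)

lemma eval_single: "eval (Poly_Mapping.single w k) = scale k (foldr T w v0)"
  by (simp add: free_eval_def)

lemma eval_one: "eval 1 = v0"
  using eval_single [of "[]" 1] const_1 [where 'a = 'x] by (simp add: const_def)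

lemma eval_const: "eval (const k * u) = scale k (eval u)"
  by (induction u rule: falg_induct)
     (simp_all add: eval_zero eval_add eval_single distrib_left scale_right_distrib const_def
       Poly_Mapping.mult_single plus_list_def)

lemma eval_gen: "eval (gen x * u) = T x (eval u)"
proof (induction u rule: falg_induct)
  case zero
  show ?case using linear_map_on_0 [OF linear_T subspace_0 [OF subspace_W]] by (simp add: eval_zero)
next
  case (add u v)
  then show ?case
    by (simp add: distrib_left eval_add linear_map_onD(2) [OF linear_T] eval_in_W)
next
  case (word w k)
  then show ?case
    by (simp add: eval_single linear_map_onD(3) [OF linear_T] foldr_T_in_W flip: single_Cons)
qed

lemma eval_minus: "eval (- u) = - eval u"
  using eval_add [of u "- u"] by (simp add: eval_zero eq_neg_iff_add_eq_0 add.commute)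

lemma eval_diff: "eval (u - v) = eval u - eval v"
  using eval_add [of u "- v"] by (simp add: eval_minus)

text \<open>The kernel is the annihilator of \<open>v0\<close>. Being a left ideal, it contains a
  left ideal hull as soon as it contains the generators of the hull.\<close>

lemma left_ideal_kernel: "left_ideal {u. eval u = 0}"
proof -
  have "eval (a * u) = 0" if "eval u = 0" for a u
  proof (induction a rule: falg_induct)
    case (word w k)
    have "eval (Poly_Mapping.single w 1 * u) = 0"
    proof (induction w)
      case Nil
      then show ?case using that by (simp flip: zero_list_def)
    next
      case (Cons x w)
      then show ?case
        using linear_map_on_0 [OF linear_T subspace_0 [OF subspace_W]]
        by (simp add: single_Cons [of x] mult.assoc eval_gen)
    qed
    then show ?case
      by (simp add: single_eq_const_mult [of w k] mult.assoc eval_const)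
  qed (simp_all add: eval_zero eval_add distrib_right)
  then show ?thesis
    by (simp add: left_ideal_def eval_zero eval_add)
qed

text \<open>The choice of the representative is immaterial only if \<open>J\<close> lies in the kernel of \<open>eval\<close>.\<close>

definition descend :: "'x falg set \<Rightarrow> 'x falg cyc \<Rightarrow> 'v" where
  "descend J = restrict (\<lambda>v. eval (SOME u. coset J u = v)) (quot_module J)"

context
  fixes J assumes J: "left_ideal J" and kernel: "J \<subseteq> {u. eval u = 0}"
begin

text \<open>The chosen representative differs from \<open>u\<close> by an element of
  \<open>J\<close>, on which \<open>eval\<close> vanishes.\<close>

lemma descend_coset: "descend J (coset J u) = eval u"
proof -
  have "coset J (SOME u'. coset J u' = coset J u) = coset J u"
    by (rule someI [of _ u]) simp
  then have "eval ((SOME u'. coset J u' = coset J u) - u) = 0"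
    using kernel by (auto simp: coset_eq_iff [OF J])
  then show ?thesis
    by (simp add: descend_def quot_module_def eval_diff)
qed

lemma linear_descend: "linear_map_on cscale (quot_module J) scale W (descend J)"
  unfolding linear_map_on_def quot_module_def
  by (auto simp: descend_coset eval_in_W eval_add eval_const cscale_def act_coset simp flip: coset_add)

lemma descend_act_gen: "v \<in> quot_module J \<Longrightarrow> descend J (act (gen x) v) = T x (descend J v)"
  unfolding quot_module_def by (auto simp: descend_coset act_coset eval_gen)

lemma descend_one: "descend J (coset J 1) = v0"
  by (simp add: descend_coset eval_one)

end

end

section \<open>Quotients of the free algebra defined by super-commutation relations\<close>

lemma incl_zero: "incl 0 = 0"
  by (simp add: incl_def)

lemma incl_single: "incl (Poly_Mapping.single x k) = const k * gen x"
  by (cases "k = 0") (simp_all add: incl_def const_def Poly_Mapping.single_zero)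

lemma const_0: "const 0 = 0"
  by (simp add: const_def)

lemma incl_add: "incl (u + v) = incl u + incl v"
  unfolding incl_def
  by (rule setsum_keys_plus_distrib) (simp_all add: const_add distrib_right const_0)

lemma incl_minus: "incl (- u) = - incl u"
  using incl_add [of u "- u"] by (simp add: incl_zero eq_neg_iff_add_eq_0 add.commute)

lemma act_scale: "act u (cscale k v) = cscale k (act u v)"
  by (simp add: cscale_def act_act const_commute)

lemma act_zero_left: "act 0 v = 0"
  using act_add_left [of 0 0 v] by simp

lemma act_zero_right: "act u 0 = 0"
  using act_add_right [of u 0 0] by simp

lemma act_minus_left: "act (- u) v = - act u v"
  using act_add_left [of u "- u" v] by (simp add: act_zero_left eq_neg_iff_add_eq_0 add.commute)

lemma act_minus_right: "act u (- v) = - act u v"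
  using act_add_right [of u v "- v"] by (simp add: act_zero_right eq_neg_iff_add_eq_0 add.commute)

lemma act_diff_left: "act (u - v) w = act u w - act v w"
  using act_add_left [of u "- v" w] by (simp add: act_minus_left)

lemma act_diff_right: "act u (v - w) = act u v - act u w"
  using act_add_right [of u v "- w"] by (simp add: act_minus_right)

lemma act_const: "act (const k) v = cscale k v"
  by (simp add: cscale_def)

lemma act_sign: "act ((- 1) ^ n * u) v = cscale ((- 1) ^ n) (act u v)"
  by (cases "even n") (simp_all add: act_minus_left)

lemma act_in_quot_module: "v \<in> quot_module J \<Longrightarrow> act u v \<in> quot_module J"
  by (auto simp: quot_module_def act_coset)

text \<open>Classes of words span the quotient. The case \<open>gen\<close> is posed only for such
  classes because they are homogeneous, which \<open>V_induct\<close> exploits.\<close>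

lemma quot_module_induct [consumes 1, case_names zero add scale one gen]:
  fixes J :: "'x falg set"
  assumes v: "v \<in> quot_module J"
    and zero: "P 0"
    and add: "\<And>u v. u \<in> quot_module J \<Longrightarrow> v \<in> quot_module J \<Longrightarrow> P u \<Longrightarrow> P v \<Longrightarrow> P (u + v)"
    and scale: "\<And>k v. v \<in> quot_module J \<Longrightarrow> P v \<Longrightarrow> P (cscale k v)"
    and one: "P (coset J 1)"
    and gen: "\<And>x w. P (coset J (Poly_Mapping.single w 1)) \<Longrightarrow> P (act (gen x) (coset J (Poly_Mapping.single w 1)))"
  shows "P v"
proof -
  have in_quot: "coset J u \<in> quot_module J" for u
    by (simp add: quot_module_def)
  have P_word: "P (coset J (Poly_Mapping.single w 1))" for w
    by (induction w)
       (use one gen const_1 [where 'a = 'x] in \<open>auto simp: const_def act_coset single_Cons [of x w 1 for x w]\<close>)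
  obtain u where "v = coset J u" using v by (auto simp: quot_module_def)
  moreover have "P (coset J u)"
  proof (induction u rule: falg_induct)
    case zero
    then show ?case using assms(2) coset_add [of J 0 0] by simp
  next
    case (word w k)
    show ?case
      using scale [OF in_quot P_word, of k w] single_eq_const_mult [of w k]
      by (simp add: cscale_def act_coset)
  qed (simp add: coset_add add in_quot)
  ultimately show ?thesis by simp
qed

lemma coset_word_degree:
  "coset J (Poly_Mapping.single w k) \<in> quot_grading wt J (sum_list (map wt w))"
  by (auto simp: quot_grading_def)

text \<open>Left multiplication by \<open>gen x\<close> prepends the letter \<open>x\<close> to
  every word of a representative.\<close>

lemma act_gen_degree:
  assumes "v \<in> quot_grading wt J d"
  shows "act (gen x) v \<in> quot_grading wt J (wt x + d)"
proof -
  obtain u where u: "v = coset J u" "\<forall>w\<in>Poly_Mapping.keys u. sum_list (map wt w) = d"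
    using assms by (auto simp: quot_grading_def)
  have "sum_list (map wt w) = wt x + d" if "w \<in> Poly_Mapping.keys (gen x * u)" for w
    using keys_mult [of "gen x" u] that u(2) by (auto simp: gen_def plus_list_def)
  then show ?thesis
    by (auto simp: u(1) act_coset quot_grading_def)
qed

text \<open>A left ideal need not be closed under right multiplication; the right factor
  \<open>v\<close> makes the relations hold on every vector of the quotient and not only on the
  class of 1.\<close>

locale super_relations =
  fixes par :: "'x \<Rightarrow> nat" and br :: "'x \<Rightarrow> 'x \<Rightarrow> ('x \<Rightarrow>\<^sub>0 complex)" and J :: "'x falg set"
  assumes J: "left_ideal J"
    and env_rel_in_J: "env_rel par br x y * v \<in> J"
begin

lemma act_commute:
  assumes "v \<in> quot_module J"
  shows "act (gen x) (act (gen y) v)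
    = cscale ((- 1) ^ (par x * par y)) (act (gen y) (act (gen x) v)) + act (incl (br x y)) v"
proof -
  obtain u where u: "v = coset J u" using assms by (auto simp: quot_module_def)
  have "act (env_rel par br x y) v = 0"
    using env_rel_in_J [of x y u] coset_eq_iff [OF J, of "env_rel par br x y * u" 0] coset_add [of J 0 0]
    by (simp add: u act_coset)
  then have "act (gen x * gen y) v - cscale ((- 1) ^ (par x * par y)) (act (gen y * gen x) v)
      - act (incl (br x y)) v = 0"
    by (simp add: env_rel_def act_diff_left act_sign)
  then show ?thesis
    by (simp add: act_act diff_diff_eq)
qed

text \<open>The generator acts by \<open>k\<close> on the cyclic vector and commutes with all
  generators, so it acts by \<open>k\<close> on everything they produce.\<close>

lemma act_central:
  assumes central: "par z = 0" "\<And>x. br z x = 0" and "gen z - const k \<in> J" and v: "v \<in> quot_module J"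
  shows "act (gen z) v = cscale k v"
  using v
proof (induction v rule: quot_module_induct)
  case one
  show ?case using assms(3) by (simp add: act_coset cscale_def coset_eq_iff [OF J])
next
  case (gen x w)
  have "coset J (Poly_Mapping.single w 1) \<in> quot_module J" by (simp add: quot_module_def)
  from act_commute [OF this, of z x] gen show ?case
    by (simp add: central incl_zero act_zero_left act_scale)
qed (simp_all add: act_zero_right act_add_right cscale.scale_right_distrib act_scale mult.commute)

end

lemma left_ideal_induced_ideal: "left_ideal (induced_ideal par br P \<chi>)"
  unfolding induced_ideal_def by (rule left_ideal_hull)

lemma env_rel_in_induced_ideal: "env_rel par br x y * v \<in> induced_ideal par br P \<chi>"
  unfolding induced_ideal_def by (rule hull_inc) blast

lemma gen_in_induced_ideal: "x \<in> P \<Longrightarrow> gen x - const (\<chi> x) \<in> induced_ideal par br P \<chi>"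
  unfolding induced_ideal_def by (rule hull_inc) blast

interpretation hc: super_relations hc_par hc_br hc_ideal
  by standard (simp_all add: hc_ideal_def left_ideal_induced_ideal env_rel_in_induced_ideal)

interpretation bms: super_relations bms_par bms_br "vac_ideal c1 c2"
  unfolding vac_ideal_def
  by standard (auto intro: left_ideal_hull hull_inc env_rel_in_induced_ideal)

lemma act_C1B: "v \<in> V_bms c1 c2 \<Longrightarrow> act (gen C1B) v = cscale c1 v"
  and act_C2B: "v \<in> V_bms c1 c2 \<Longrightarrow> act (gen C2B) v = cscale c2 v"
proof -
  have "gen x - const (bms_char c1 c2 x) \<in> vac_ideal c1 c2" if "x \<in> {C1B, C2B}" for x
    unfolding vac_ideal_def using that
    by (intro hull_inc UnI1 gen_in_induced_ideal) (auto simp: bms_nonneg_def)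
  from this [of C1B] this [of C2B]
  show "v \<in> V_bms c1 c2 \<Longrightarrow> act (gen C1B) v = cscale c1 v"
    and "v \<in> V_bms c1 c2 \<Longrightarrow> act (gen C2B) v = cscale c2 v"
    by (auto simp: V_bms_def intro!: bms.act_central)
qed

section \<open>The Heisenberg-Clifford modes\<close>

lemma act_KH: "w \<in> M_hc \<Longrightarrow> act (gen KH) w = w"
  using hc.act_central [of KH 1 w] gen_in_induced_ideal [of KH hc_nonneg hc_char hc_par hc_br]
  by (simp add: hc_ideal_def M_hc_def hc_nonneg_def)

lemma act_vac_hc: "x \<in> hc_nonneg \<Longrightarrow> hc_char x = 0 \<Longrightarrow> act (gen x) vac_hc = 0"
  using gen_in_induced_ideal [of x hc_nonneg hc_char hc_par hc_br]
    coset_eq_iff [OF hc.J, of "gen x" 0] coset_add [of hc_ideal 0 0]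
  by (simp add: vac_hc_def act_coset hc_ideal_def const_def)

lemmas hc_op_defs = a_op_def b_op_def c_op_def

lemma hc_op_vac:
  "n \<ge> 0 \<Longrightarrow> a_op n vac_hc = 0" "n \<ge> 0 \<Longrightarrow> b_op n vac_hc = 0" "n \<ge> 0 \<Longrightarrow> c_op n vac_hc = 0"
proof -
  \<comment> \<open>\<open>c_op n\<close> has the half-integral index n + 1/2, so the annihilating
    modes of \<open>c\<close> are again those with n \<ge> 0.\<close>
  have "n \<ge> 0 \<Longrightarrow> half n > (0 :: rat)"
    by (simp add: half_def add_nonneg_pos)
  then show "n \<ge> 0 \<Longrightarrow> a_op n vac_hc = 0" "n \<ge> 0 \<Longrightarrow> b_op n vac_hc = 0" "n \<ge> 0 \<Longrightarrow> c_op n vac_hc = 0"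
    unfolding hc_op_defs by (auto intro!: act_vac_hc simp: hc_nonneg_def)
qed

lemma hc_op_in: "w \<in> M_hc \<Longrightarrow> a_op n w \<in> M_hc" "w \<in> M_hc \<Longrightarrow> b_op n w \<in> M_hc" "w \<in> M_hc \<Longrightarrow> c_op n w \<in> M_hc"
  unfolding hc_op_defs M_hc_def by (simp_all add: act_in_quot_module)

lemma hc_op_linear:
  "a_op n (v + w) = a_op n v + a_op n w" "b_op n (v + w) = b_op n v + b_op n w" "c_op n (v + w) = c_op n v + c_op n w"
  "a_op n (v - w) = a_op n v - a_op n w" "b_op n (v - w) = b_op n v - b_op n w" "c_op n (v - w) = c_op n v - c_op n w"
  "a_op n (- w) = - a_op n w" "b_op n (- w) = - b_op n w" "c_op n (- w) = - c_op n w"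
  "a_op n (cscale k w) = cscale k (a_op n w)" "b_op n (cscale k w) = cscale k (b_op n w)" "c_op n (cscale k w) = cscale k (c_op n w)"
  "a_op n 0 = 0" "b_op n 0 = 0" "c_op n 0 = 0"
  unfolding hc_op_defs
  by (simp_all add: act_add_right act_diff_right act_minus_right act_scale act_zero_right)

lemma hc_commute:
  assumes "w \<in> M_hc"
  shows "a_op m (a_op n w) = a_op n (a_op m w)"
    and "b_op m (b_op n w) = b_op n (b_op m w)"
    and "c_op m (a_op n w) = a_op n (c_op m w)"
    and "c_op m (b_op n w) = b_op n (c_op m w)"
    and "a_op m (b_op n w) = b_op n (a_op m w) + (if m + n = 0 then cscale (of_int m) w else 0)"
    and "c_op m (c_op n w) = - c_op n (c_op m w) + (if m + n + 1 = 0 then w else 0)"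
  using hc.act_commute [of w "AH m" "AH n"] hc.act_commute [of w "BH m" "BH n"]
    hc.act_commute [of w "CH m" "AH n"] hc.act_commute [of w "CH m" "BH n"]
    hc.act_commute [of w "AH m" "BH n"] hc.act_commute [of w "CH m" "CH n"] assms act_KH [OF assms]
  unfolding hc_op_defs M_hc_def
  by (simp_all add: incl_zero incl_single act_zero_left hc_AB_def act_const flip: act_act)

lemma hc_op_degree:
  "w \<in> quot_grading hc_wt hc_ideal d \<Longrightarrow> a_op n w \<in> quot_grading hc_wt hc_ideal (- of_int n + d)"
  "w \<in> quot_grading hc_wt hc_ideal d \<Longrightarrow> b_op n w \<in> quot_grading hc_wt hc_ideal (- of_int n + d)"
  "w \<in> quot_grading hc_wt hc_ideal d \<Longrightarrow> c_op n w \<in> quot_grading hc_wt hc_ideal (- half n + d)"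
  unfolding hc_op_defs
  using act_gen_degree [of w hc_wt hc_ideal d "AH n"] act_gen_degree [of w hc_wt hc_ideal d "BH n"]
    act_gen_degree [of w hc_wt hc_ideal d "CH n"]
  by simp_all

lemma parity_of_degree_half:
  "parity_of_degree (1 / 2) = 1" "parity_of_degree (3 / 2) = 1" "parity_of_degree 1 = 0" "parity_of_degree 2 = 0"
proof -
  have "of_int (2 * n) \<noteq> (of_int 1 :: rat)" "of_int (2 * n) \<noteq> (of_int 3 :: rat)" for n
    unfolding of_int_eq_iff by presburger+
  then have "(1 / 2 :: rat) \<noteq> of_int n" "(3 / 2 :: rat) \<noteq> of_int n" for n
    by (auto simp: divide_eq_eq mult.commute dest: sym)
  then show "parity_of_degree (1 / 2) = 1" "parity_of_degree (3 / 2) = 1"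
    by (auto simp: parity_of_degree_def elim!: Ints_cases)
qed (simp_all add: parity_of_degree_def)

lemma koszul_simps:
  "koszul 1 e = 1" "koszul 2 e = 1" "koszul d 1 = 1" "koszul d 2 = 1"
  "koszul (1 / 2) (1 / 2) = - 1" "koszul (1 / 2) (3 / 2) = - 1" "koszul (3 / 2) (1 / 2) = - 1" "koszul (3 / 2) (3 / 2) = - 1"
  by (simp_all add: koszul_def parity_of_degree_half)

section \<open>The three states in the Heisenberg-Clifford vertex superalgebra\<close>

locale hc_vertex =
  fixes D :: "hc falg cyc \<Rightarrow> hc falg cyc" and Y :: "hc falg cyc \<Rightarrow> int \<Rightarrow> hc falg cyc \<Rightarrow> hc falg cyc"
    and \<rho> :: complex
  assumes hc_vertex_superalgebra: "hc_vertex_superalgebra D Y"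
begin

sublocale vertex_superalgebra cscale M_hc "quot_grading hc_wt hc_ideal" vac_hc D Y
  using hc_vertex_superalgebra by (simp add: hc_vertex_superalgebra_def)

abbreviation "gr \<equiv> quot_grading hc_wt hc_ideal"
abbreviation "a \<equiv> a_op (- 1) vac_hc"
abbreviation "b \<equiv> b_op (- 1) vac_hc"
abbreviation "c \<equiv> c_op (- 1) vac_hc"

definition "\<omega>L = a_op (- 1) b + cscale \<rho> (a_op (- 2) vac_hc) + cscale (1 / 2) (c_op (- 2) c)"
definition "\<omega>M = cscale (1 / 2) (b_op (- 1) b) + cscale \<rho> (b_op (- 2) vac_hc)"
definition "\<omega>Q = b_op (- 1) c + cscale (2 * \<rho>) (c_op (- 2) vac_hc)"

lemma generator_degree: "a \<in> gr 1" "b \<in> gr 1" "c \<in> gr (1 / 2)"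
  using hc_op_degree [OF vac_degree, of "- 1"] by (simp_all add: half_def)

lemma conformal_degree: "\<omega>L \<in> gr 2" "\<omega>M \<in> gr 2" "\<omega>Q \<in> gr (3 / 2)"
proof -
  note add = cscale.subspace_add [OF subspace_gr] and scale = cscale.subspace_scale [OF subspace_gr]
  note deg = hc_op_degree [where n = "- 1"] hc_op_degree [where n = "- 2"]
  have "a_op (- 1) b \<in> gr 2" "a_op (- 2) vac_hc \<in> gr 2" "c_op (- 2) c \<in> gr 2"
    "b_op (- 1) b \<in> gr 2" "b_op (- 2) vac_hc \<in> gr 2"
    "b_op (- 1) c \<in> gr (3 / 2)" "c_op (- 2) vac_hc \<in> gr (3 / 2)"
    using deg [OF vac_degree] deg [OF generator_degree(2)] deg [OF generator_degree(3)]
    by (simp_all add: half_def)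
  then show "\<omega>L \<in> gr 2" "\<omega>M \<in> gr 2" "\<omega>Q \<in> gr (3 / 2)"
    unfolding \<omega>L_def \<omega>M_def \<omega>Q_def by (auto intro!: add scale)
qed

lemmas in_M [simp] = vac_in_V hc_op_in add_in_V scale_in_V zero_in_V Y_in_V D_in_V
  gr_in_V [OF conformal_degree(1)] gr_in_V [OF conformal_degree(2)] gr_in_V [OF conformal_degree(3)]

lemma Y_generators [simp]:
  assumes "w \<in> M_hc"
  shows "Y a n w = a_op n w" "Y b n w = b_op n w" "Y c n w = c_op n w"
  using hc_vertex_superalgebra assms by (simp_all add: hc_vertex_superalgebra_def)

text \<open>Together with \<open>D_vac\<close> these rules compute \<open>D\<close> on states
  written as modes on the vacuum, so that the products of index 0 can be recognized as
  derivatives.\<close>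

lemma D_op:
  assumes "w \<in> M_hc"
  shows "D (a_op n w) = a_op n (D w) - cscale (of_int n) (a_op (n - 1) w)"
    and "D (b_op n w) = b_op n (D w) - cscale (of_int n) (b_op (n - 1) w)"
    and "D (c_op n w) = c_op n (D w) - cscale (of_int n) (c_op (n - 1) w)"
  using translation(2) [of a w n] translation(2) [of b w n] translation(2) [of c w n] assms
  by (simp_all add: algebra_simps)

lemma D_generator: "D a = a_op (- 2) vac_hc" "D b = b_op (- 2) vac_hc" "D c = c_op (- 2) vac_hc"
  by (simp_all add: D_op D_vac hc_op_linear)

lemma Y_derivative:
  assumes "w \<in> M_hc"
  shows "Y (a_op (- 2) vac_hc) n w = cscale (- of_int n) (a_op (n - 1) w)"
    and "Y (b_op (- 2) vac_hc) n w = cscale (- of_int n) (b_op (n - 1) w)"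
    and "Y (c_op (- 2) vac_hc) n w = cscale (- of_int n) (c_op (n - 1) w)"
  using assms by (simp_all add: Y_D flip: D_generator)

text \<open>Annihilating modes move to the right of creating ones, towards the vacuum. The sign
  conditions orient the relations, which could otherwise be applied back and forth.\<close>

lemma hc_commute_nonneg:
  assumes "i \<ge> 0" "n < 0" "w \<in> M_hc"
  shows "a_op i (a_op n w) = a_op n (a_op i w)"
    and "a_op i (c_op n w) = c_op n (a_op i w)"
    and "b_op i (b_op n w) = b_op n (b_op i w)"
    and "b_op i (c_op n w) = c_op n (b_op i w)"
    and "c_op i (a_op n w) = a_op n (c_op i w)"
    and "c_op i (b_op n w) = b_op n (c_op i w)"
    and "a_op i (b_op n w) = b_op n (a_op i w) + (if i + n = 0 then cscale (of_int i) w else 0)"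
    and "b_op i (a_op n w) = a_op n (b_op i w) + (if i + n = 0 then cscale (of_int i) w else 0)"
    and "c_op i (c_op n w) = - c_op n (c_op i w) + (if i + n + 1 = 0 then w else 0)"
proof -
  show "b_op i (a_op n w) = a_op n (b_op i w) + (if i + n = 0 then cscale (of_int i) w else 0)"
    \<comment> \<open>Exchanging \<open>a\<close> and \<open>b\<close> yields the scalar
      \<open>- n\<close>, which is \<open>i\<close> in the only case that contributes.\<close>
    using hc_commute(5) [OF assms(3), of n i] by (cases "n = - i") auto
  show "a_op i (c_op n w) = c_op n (a_op i w)" "b_op i (c_op n w) = c_op n (b_op i w)"
    by (rule sym, rule hc_commute [OF assms(3)])+
qed (rule hc_commute [OF assms(3)])+

lemmas hc_commute_numeral = hc_commute_nonneg [where n = "- 1"] hc_commute_nonneg [where n = "- 2"]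

text \<open>Only brackets survive at the vacuum. The vacuum term for \<open>b\<close> comes from
  pairing \<open>b_op 2\<close> with the correction \<open>\<rho> a_op (- 2)\<close>;
  \<open>a\<close> has no such term because it pairs trivially with itself.\<close>

lemma a_on_\<omega>L: "i \<ge> 0 \<Longrightarrow> a_op i \<omega>L = (if i = 1 then a else 0)"
  and b_on_\<omega>L: "i \<ge> 0 \<Longrightarrow> b_op i \<omega>L = (if i = 1 then b else if i = 2 then cscale (2 * \<rho>) vac_hc else 0)"
  and c_on_\<omega>L: "i \<ge> 0 \<Longrightarrow> c_op i \<omega>L =
    (if i = 0 then cscale (- 1 / 2) (c_op (- 2) vac_hc) else if i = 1 then cscale (1 / 2) c else 0)"
  by (simp_all add: \<omega>L_def hc_op_linear hc_commute_numeral hc_op_vac)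

lemma b_on_\<omega>M: "i \<ge> 0 \<Longrightarrow> b_op i \<omega>M = 0"
  and c_on_\<omega>M: "i \<ge> 0 \<Longrightarrow> c_op i \<omega>M = 0"
  and b_on_\<omega>Q: "i \<ge> 0 \<Longrightarrow> b_op i \<omega>Q = 0"
  and c_on_\<omega>Q: "i \<ge> 0 \<Longrightarrow> c_op i \<omega>Q =
    (if i = 0 then b else if i = 1 then cscale (2 * \<rho>) vac_hc else 0)"
  by (simp_all add: \<omega>M_def \<omega>Q_def hc_op_linear hc_commute_numeral hc_op_vac)

text \<open>With \<open>a\<close> as first argument the commutator formula needs only the products
  in \<open>a_on_\<omega>L\<close>; the modes of the quadratic state are never expanded. The next
  lemmas proceed alike.\<close>

lemma \<omega>L_a: "w \<in> M_hc \<Longrightarrow> Y \<omega>L n (a_op m w) = a_op m (Y \<omega>L n w) - cscale (of_int m) (a_op (m + n - 1) w)"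
  using commutator_fourth_order_pole [OF generator_degree(1) conformal_degree(1), of w 0 a 0 0 m n]
  by (simp add: a_on_\<omega>L Y_zero_left koszul_simps algebra_simps)

text \<open>The anomalous scalar is the term of index 2, a multiple of the vacuum, whose field has
  only the mode -1; this forces \<open>m + n - 2 = -1\<close>.\<close>

lemma \<omega>L_b: "w \<in> M_hc \<Longrightarrow> Y \<omega>L n (b_op m w) = b_op m (Y \<omega>L n w) - cscale (of_int m) (b_op (m + n - 1) w)
    - (if m + n = 1 then cscale (\<rho> * of_int m * (of_int m - 1)) w else 0)"
  using commutator_fourth_order_pole [OF generator_degree(2) conformal_degree(1), of w 0 b "cscale (2 * \<rho>) vac_hc" 0 m n]
  by (cases "m + n = 1") (simp_all add: b_on_\<omega>L Y_zero_left Y_scale_left vacuum koszul_simps algebra_simps diff_divide_distrib)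

lemma \<omega>L_c: "w \<in> M_hc \<Longrightarrow>
    Y \<omega>L n (c_op m w) = c_op m (Y \<omega>L n w) - cscale (of_int m + of_int n / 2) (c_op (m + n - 1) w)"
  using commutator_fourth_order_pole [OF generator_degree(3) conformal_degree(1), of w
    "cscale (- 1 / 2) (c_op (- 2) vac_hc)" "cscale (1 / 2) c" 0 0 m n]
    \<comment> \<open>The derivative term contributes (m + n)/2 and the term of index 1 contributes
      m/2; the two halves of m must be merged.\<close>
    cscale.scale_left_distrib [of "of_int m / 2" "of_int m / 2" "c_op (m + n - 1) w"]
  by (simp add: c_on_\<omega>L Y_zero_left Y_scale_left Y_minus_left Y_derivative koszul_simps algebra_simps)

lemma \<omega>M_b: "w \<in> M_hc \<Longrightarrow> Y \<omega>M n (b_op m w) = b_op m (Y \<omega>M n w)"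
  using commutator_fourth_order_pole [OF generator_degree(2) conformal_degree(2), of w 0 0 0 0 m n]
  by (simp add: b_on_\<omega>M Y_zero_left koszul_simps)

lemma \<omega>M_c: "w \<in> M_hc \<Longrightarrow> Y \<omega>M n (c_op m w) = c_op m (Y \<omega>M n w)"
  using commutator_fourth_order_pole [OF generator_degree(3) conformal_degree(2), of w 0 0 0 0 m n]
  by (simp add: c_on_\<omega>M Y_zero_left koszul_simps)

lemma \<omega>Q_b: "w \<in> M_hc \<Longrightarrow> Y \<omega>Q n (b_op m w) = b_op m (Y \<omega>Q n w)"
  using commutator_fourth_order_pole [OF generator_degree(2) conformal_degree(3), of w 0 0 0 0 m n]
  by (simp add: b_on_\<omega>Q Y_zero_left koszul_simps)

lemma \<omega>Q_c: "w \<in> M_hc \<Longrightarrow> Y \<omega>Q n (c_op m w) = - c_op m (Y \<omega>Q n w) + b_op (m + n) w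
    + (if m + n = 0 then cscale (2 * \<rho> * of_int m) w else 0)"
  using commutator_fourth_order_pole [OF generator_degree(3) conformal_degree(3), of w b "cscale (2 * \<rho>) vac_hc" 0 0 m n]
  by (simp add: c_on_\<omega>Q Y_zero_left Y_scale_left vacuum koszul_simps algebra_simps)

lemma \<omega>_vac: "i \<ge> 0 \<Longrightarrow> Y \<omega>L i vac_hc = 0" "i \<ge> 0 \<Longrightarrow> Y \<omega>M i vac_hc = 0" "i \<ge> 0 \<Longrightarrow> Y \<omega>Q i vac_hc = 0"
  by (simp_all add: creation)

lemma Y_linear:
  assumes "u \<in> M_hc" "v \<in> M_hc"
  shows "w \<in> M_hc \<Longrightarrow> Y u n (v + w) = Y u n v + Y u n w" "Y u n (cscale k v) = cscale k (Y u n v)"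
  using assms by (simp_all add: Y_add_right Y_scale_right)

lemma D_linear: "v \<in> M_hc \<Longrightarrow> w \<in> M_hc \<Longrightarrow> D (v + w) = D v + D w" "v \<in> M_hc \<Longrightarrow> D (cscale k v) = cscale k (D v)"
  using linear_map_onD(2,3) [OF linear_D] by auto

lemmas mode_simps = Y_linear hc_op_linear \<omega>L_a \<omega>L_b \<omega>L_c \<omega>M_b \<omega>M_c \<omega>Q_b \<omega>Q_c \<omega>_vac
  hc_op_vac hc_commute_numeral D_op D_vac D_linear

text \<open>These rules collect multiples of one vector after an expansion into sorted
  modes.\<close>

lemma combine_scalars:
  "cscale k x + cscale l x = cscale (k + l) x"
  "cscale k x + (cscale l x + y) = cscale (k + l) x + y"
  "x + cscale l x = cscale (1 + l) x"
  "x + (cscale l x + y) = cscale (1 + l) x + y"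
  "cscale l x + x = cscale (l + 1) x"
  "cscale l x + (x + y) = cscale (l + 1) x + y"
  "x + x = cscale 2 x"
  "x + (x + y) = cscale 2 x + y"
  "- x - x = - cscale 2 x"
  using cscale.scale_left_distrib [of 1 1 x] by (simp_all add: cscale.scale_left_distrib)

text \<open>The index n + 1/2 is never zero, so the anticommutator of this odd mode with itself
  vanishes and twice its square is zero.\<close>

lemma c_square: "c_op n (c_op n w) = 0" if "w \<in> M_hc"
proof -
  have "n + n + 1 \<noteq> 0" by presburger
  then have "c_op n (c_op n w) = - c_op n (c_op n w)"
    using hc_commute(6) [OF that, of n n] by (simp only: if_False add_0_right)
  then have "cscale (1 + 1) (c_op n (c_op n w)) = 0"
    unfolding cscale.scale_left_distrib by (simp add: eq_neg_iff_add_eq_0)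
  then show ?thesis by simp
qed

text \<open>Creating modes get a fixed order, so that equal states acquire equal normal
  forms.\<close>

lemma sort_modes:
  assumes "w \<in> M_hc"
  shows "b_op (- 1) (b_op (- 2) w) = b_op (- 2) (b_op (- 1) w)"
    and "c_op (- 1) (c_op (- 2) w) = - c_op (- 2) (c_op (- 1) w)"
  using hc_commute(2) [OF assms] hc_commute(6) [OF assms, of "- 1" "- 2"] by simp_all

section \<open>Products of the three states and brackets of their modes\<close>

text \<open>Unfolding \<open>\<omega>L_def\<close> in \<open>Y \<omega>L n \<omega>L\<close> would also unfold the left operand, to which the rules for the
  modes of \<open>\<omega>L\<close> apply; hence the expansion rules with a context.\<close>

lemma expand_\<omega>L:
  "Y u n \<omega>L = Y u n (a_op (- 1) b + cscale \<rho> (a_op (- 2) vac_hc) + cscale (1 / 2) (c_op (- 2) c))"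
  "D \<omega>L = D (a_op (- 1) b + cscale \<rho> (a_op (- 2) vac_hc) + cscale (1 / 2) (c_op (- 2) c))"
  "cscale k \<omega>L = cscale k (a_op (- 1) b + cscale \<rho> (a_op (- 2) vac_hc) + cscale (1 / 2) (c_op (- 2) c))"
  by (simp_all only: \<omega>L_def)

lemma expand_\<omega>M:
  "Y u n \<omega>M = Y u n (cscale (1 / 2) (b_op (- 1) b) + cscale \<rho> (b_op (- 2) vac_hc))"
  "D \<omega>M = D (cscale (1 / 2) (b_op (- 1) b) + cscale \<rho> (b_op (- 2) vac_hc))"
  "cscale k \<omega>M = cscale k (cscale (1 / 2) (b_op (- 1) b) + cscale \<rho> (b_op (- 2) vac_hc))"
  by (simp_all only: \<omega>M_def)

lemma expand_\<omega>Q: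
  "Y u n \<omega>Q = Y u n (b_op (- 1) c + cscale (2 * \<rho>) (c_op (- 2) vac_hc))"
  "D \<omega>Q = D (b_op (- 1) c + cscale (2 * \<rho>) (c_op (- 2) vac_hc))"
  "cscale k \<omega>Q = cscale k (b_op (- 1) c + cscale (2 * \<rho>) (c_op (- 2) vac_hc))"
  by (simp_all only: \<omega>Q_def)

lemma \<omega>M_on_\<omega>M: "i \<ge> 0 \<Longrightarrow> Y \<omega>M i \<omega>M = 0"
  by (simp add: expand_\<omega>M mode_simps)

lemma \<omega>M_on_\<omega>Q: "i \<ge> 0 \<Longrightarrow> Y \<omega>M i \<omega>Q = 0"
  by (simp add: expand_\<omega>Q mode_simps)

text \<open>The vacuum coefficient is two thirds of the second central charge
  \<open>- 12 * \<rho>\<^sup>2\<close>.\<close>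

lemma \<omega>Q_on_\<omega>Q:
  "Y \<omega>Q 0 \<omega>Q = cscale 2 \<omega>M"
  "Y \<omega>Q 1 \<omega>Q = 0"
  "Y \<omega>Q 2 \<omega>Q = cscale (- 8 * \<rho>\<^sup>2) vac_hc"
  "i \<ge> 3 \<Longrightarrow> Y \<omega>Q i \<omega>Q = 0"
  by (simp_all add: expand_\<omega>Q expand_\<omega>M mode_simps cscale.scale_right_distrib
      power2_eq_square combine_scalars mult_ac)

text \<open>At index 2 the anomaly of \<open>b\<close> in the quadratic part cancels against the
  linear correction; the same happens for the other two states. At index 3 the anomaly meets
  \<open>\<rho> b_op (- 2)\<close> and leaves half of the second central charge.\<close>

lemma \<omega>L_on_\<omega>M:
  "Y \<omega>L 0 \<omega>M = D \<omega>M"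
  "Y \<omega>L 1 \<omega>M = cscale 2 \<omega>M"
  "Y \<omega>L 2 \<omega>M = 0"
  "Y \<omega>L 3 \<omega>M = cscale (- 6 * \<rho>\<^sup>2) vac_hc"
  "i \<ge> 4 \<Longrightarrow> Y \<omega>L i \<omega>M = 0"
  by (simp_all add: expand_\<omega>M mode_simps c_square sort_modes cscale.scale_right_distrib
      cscale.scale_right_diff_distrib power2_eq_square combine_scalars mult_ac)

lemma \<omega>L_on_\<omega>Q:
  "Y \<omega>L 0 \<omega>Q = D \<omega>Q"
  "Y \<omega>L 1 \<omega>Q = cscale (3 / 2) \<omega>Q"
  "Y \<omega>L 2 \<omega>Q = 0"
  "i \<ge> 3 \<Longrightarrow> Y \<omega>L i \<omega>Q = 0"
  by (simp_all add: expand_\<omega>Q mode_simps c_square sort_modes cscale.scale_right_distrib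
      cscale.scale_right_diff_distrib combine_scalars mult_ac)

text \<open>The value at index 3 is half of the first central charge: the pair \<open>a\<close>,
  \<open>b\<close> contributes 1 and the fermion \<open>c\<close> contributes 1/4. The corrections
  in \<rho> do not contribute there.\<close>

lemma \<omega>L_on_\<omega>L:
  "Y \<omega>L 0 \<omega>L = D \<omega>L"
  "Y \<omega>L 1 \<omega>L = cscale 2 \<omega>L"
  "Y \<omega>L 2 \<omega>L = 0"
  "Y \<omega>L 3 \<omega>L = cscale (5 / 4) vac_hc"
  "i \<ge> 4 \<Longrightarrow> Y \<omega>L i \<omega>L = 0"
  by (simp_all add: expand_\<omega>L mode_simps c_square sort_modes cscale.scale_right_distrib
      cscale.scale_right_diff_distrib combine_scalars mult_ac)

text \<open>The products above are inserted into the commutator formula. Indices are those of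
  \<open>Y\<close>: mode m is the operator of index m - 1 for L and M and m - 1/2 for Q, so the
  central terms sit at m + n = 2 and at m + n = 1.\<close>

lemma
  assumes "w \<in> M_hc"
  shows \<omega>L_\<omega>L: "Y \<omega>L m (Y \<omega>L n w) - Y \<omega>L n (Y \<omega>L m w) = cscale (of_int (m - n)) (Y \<omega>L (m + n - 1) w)
      + (if m + n = 2 then cscale (5 / 24 * (of_int m * (of_int m - 1) * (of_int m - 2))) w else 0)"
    and \<omega>L_\<omega>M: "Y \<omega>L m (Y \<omega>M n w) - Y \<omega>M n (Y \<omega>L m w) = cscale (of_int (m - n)) (Y \<omega>M (m + n - 1) w)
      + (if m + n = 2 then cscale (- \<rho>\<^sup>2 * (of_int m * (of_int m - 1) * (of_int m - 2))) w else 0)"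
    and \<omega>L_\<omega>Q: "Y \<omega>L m (Y \<omega>Q n w) - Y \<omega>Q n (Y \<omega>L m w) = cscale (of_int m / 2 - of_int n) (Y \<omega>Q (m + n - 1) w)"
    and \<omega>M_\<omega>M: "Y \<omega>M m (Y \<omega>M n w) = Y \<omega>M n (Y \<omega>M m w)"
    and \<omega>M_\<omega>Q: "Y \<omega>M m (Y \<omega>Q n w) = Y \<omega>Q n (Y \<omega>M m w)"
    and \<omega>Q_\<omega>Q: "Y \<omega>Q m (Y \<omega>Q n w) + Y \<omega>Q n (Y \<omega>Q m w) = cscale 2 (Y \<omega>M (m + n) w)
      + (if m + n = 1 then cscale (- 4 * \<rho>\<^sup>2 * (of_int m * (of_int m - 1))) w else 0)"
proof -
  note pole = commutator_fourth_order_pole [OF _ _ assms]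
    and simps = Y_zero_left Y_minus_left Y_scale_left vacuum koszul_simps assms
  \<comment> \<open>For a state of weight k the products of index 0 and 1 are \<open>D v\<close> and
    \<open>k v\<close>; since \<open>D\<close> differentiates the field, their terms merge. It is
    applied to the three states, whose membership is \<open>in_M(10)\<close> to
    \<open>in_M(12)\<close>.\<close>
  have primary: "Y (D v) (m + n) w + cscale (of_int m) (Y (cscale k v) (m + n - 1) w)
      = cscale ((k - 1) * of_int m - of_int n) (Y v (m + n - 1) w)" if "v \<in> M_hc" for v k
    using that by (simp add: Y_D Y_scale_left assms algebra_simps)
  show "Y \<omega>L m (Y \<omega>L n w) - Y \<omega>L n (Y \<omega>L m w) = cscale (of_int (m - n)) (Y \<omega>L (m + n - 1) w)
      + (if m + n = 2 then cscale (5 / 24 * (of_int m * (of_int m - 1) * (of_int m - 2))) w else 0)"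
    using pole [OF conformal_degree(1) conformal_degree(1) \<omega>L_on_\<omega>L(1-5), of m n]
    unfolding primary [OF in_M(10)] by (cases "m + n = 2") (simp_all add: simps)
  show "Y \<omega>L m (Y \<omega>M n w) - Y \<omega>M n (Y \<omega>L m w) = cscale (of_int (m - n)) (Y \<omega>M (m + n - 1) w)
      + (if m + n = 2 then cscale (- \<rho>\<^sup>2 * (of_int m * (of_int m - 1) * (of_int m - 2))) w else 0)"
    using pole [OF conformal_degree(1) conformal_degree(2) \<omega>L_on_\<omega>M(1-5), of m n]
    unfolding primary [OF in_M(11)] by (cases "m + n = 2") (simp_all add: simps mult_ac)
  show "Y \<omega>L m (Y \<omega>Q n w) - Y \<omega>Q n (Y \<omega>L m w) = cscale (of_int m / 2 - of_int n) (Y \<omega>Q (m + n - 1) w)"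
    \<comment> \<open>Vanishing from index 3 on serves twice: for the product of index 3 and for the
      higher ones.\<close>
    using pole [OF conformal_degree(1) conformal_degree(3) \<omega>L_on_\<omega>Q(1-3) \<omega>L_on_\<omega>Q(4) \<omega>L_on_\<omega>Q(4), of m n]
    unfolding primary [OF in_M(12)] by (simp add: simps)
  show "Y \<omega>M m (Y \<omega>M n w) = Y \<omega>M n (Y \<omega>M m w)"
    using pole [OF conformal_degree(2) conformal_degree(2), of 0 0 0 0 m n]
    by (simp add: simps \<omega>M_on_\<omega>M)
  show "Y \<omega>M m (Y \<omega>Q n w) = Y \<omega>Q n (Y \<omega>M m w)"
    using pole [OF conformal_degree(2) conformal_degree(3), of 0 0 0 0 m n]
    by (simp add: simps \<omega>M_on_\<omega>Q)
  show "Y \<omega>Q m (Y \<omega>Q n w) + Y \<omega>Q n (Y \<omega>Q m w) = cscale 2 (Y \<omega>M (m + n) w)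
      + (if m + n = 1 then cscale (- 4 * \<rho>\<^sup>2 * (of_int m * (of_int m - 1))) w else 0)"
    using pole [OF conformal_degree(3) conformal_degree(3) \<omega>Q_on_\<omega>Q(1-3) \<omega>Q_on_\<omega>Q(4) \<omega>Q_on_\<omega>Q(4), of m n]
    by (cases "m + n = 1") (simp_all add: simps mult_ac)
qed

section \<open>The action of the BMS superalgebra on \<open>M_hc\<close>\<close>

fun rep :: "bms \<Rightarrow> hc falg cyc \<Rightarrow> hc falg cyc" where
  "rep (LB n) = Y \<omega>L (n + 1)"
| "rep (MB n) = Y \<omega>M (n + 1)"
| "rep (QB k) = Y \<omega>Q (k + 1)"
| "rep C1B = cscale (5 / 2)"
| "rep C2B = cscale (- 12 * \<rho>\<^sup>2)"

lemma linear_cscale: "linear_map_on cscale M_hc cscale M_hc (cscale k)"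
  by (simp add: linear_map_on_def cscale.scale_right_distrib mult.commute)

lemma linear_rep: "linear_map_on cscale M_hc cscale M_hc (rep x)"
  by (cases x) (simp_all only: rep.simps linear_Y_right in_M linear_cscale)

sublocale rep: free_representation cscale M_hc rep vac_hc
  by standard (simp_all add: subspace_V linear_rep)

text \<open>This makes the induced map preserve degrees, as the Koszul signs in
  \<open>intertwines_product\<close> require.\<close>

lemma rep_degree:
  assumes "w \<in> gr d"
  shows "rep x w \<in> gr (bms_wt x + d)"
proof (cases x)
  case (LB n)
  then show ?thesis using Y_degree [OF conformal_degree(1) assms, of "n + 1"] by (simp add: algebra_simps)
next
  case (MB n)
  then show ?thesis using Y_degree [OF conformal_degree(2) assms, of "n + 1"] by (simp add: algebra_simps)
next
  case (QB n)
  have "3 / 2 + d - of_int (n + 1) - 1 = - half n + d" by (simp add: half_def field_simps)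
  then show ?thesis using QB Y_degree [OF conformal_degree(3) assms, of "n + 1"] by (simp add: algebra_simps)
qed (simp_all only: rep.simps bms_wt.simps add_0 cscale.subspace_scale [OF subspace_gr assms])

lemma eval_sign: "rep.eval ((- 1) ^ n * u) = cscale ((- 1) ^ n) (rep.eval u)"
  by (cases "even n") (simp_all add: rep.eval_minus)

lemma eval_incl_vir:
  "rep.eval (incl (vir X C m n) * v) = cscale (of_int (m - n)) (rep (X (m + n)) (rep.eval v))
    + (if m + n = 0 then cscale (of_int (m ^ 3 - m) / 12) (rep C (rep.eval v)) else 0)"
  by (simp add: vir_def incl_add incl_single incl_zero distrib_right mult.assoc rep.eval_add
      rep.eval_const rep.eval_gen rep.eval_zero)

text \<open>The right factor only replaces the vacuum by the vector \<open>rep.eval v\<close>, and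
  the mode brackets hold on all of \<open>M_hc\<close>.\<close>

lemma eval_env_rel: "rep.eval (env_rel bms_par bms_br x y * v) = 0"
proof -
  define w where "w = rep.eval v"
  have w: "w \<in> M_hc" unfolding w_def by (rule rep.eval_in_W)
  have bracket: "rep.eval (env_rel bms_par bms_br x y * v) = rep x (rep y w)
      - cscale ((- 1) ^ (bms_par x * bms_par y)) (rep y (rep x w)) - rep.eval (incl (bms_br x y) * v)" for x y
    by (simp add: env_rel_def left_diff_distrib mult.assoc rep.eval_diff rep.eval_gen eval_sign w_def)
  \<comment> \<open>The operator of index m is mode m + 1; this shift turns the cubic of the
    commutator formula into m^3 - m.\<close>
  have cube: "of_int (m + 1) * (of_int (m + 1) - 1) * (of_int (m + 1) - 2) = (of_int (m ^ 3 - m) :: complex)" for m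
    by (simp add: power3_eq_cube algebra_simps)
  have LL: "rep (LB m) (rep (LB n) w) - rep (LB n) (rep (LB m) w) = rep.eval (incl (vir LB C1B m n) * v)" for m n
    using \<omega>L_\<omega>L [OF w, of "m + 1" "n + 1"]
    unfolding cube by (simp add: eval_incl_vir algebra_simps diff_divide_distrib flip: w_def)
  have LM: "rep (LB m) (rep (MB n) w) - rep (MB n) (rep (LB m) w) = rep.eval (incl (vir MB C2B m n) * v)" for m n
    using \<omega>L_\<omega>M [OF w, of "m + 1" "n + 1"]
    unfolding cube by (simp add: eval_incl_vir algebra_simps diff_divide_distrib flip: w_def)
  have LQ: "rep (LB m) (rep (QB k) w) - rep (QB k) (rep (LB m) w) = rep.eval (incl (bms_LQ m k) * v)" for m k
  proof -
    have coeff: "of_int (m + 1) / 2 - of_int (k + 1) = (of_int m / 2 - half k :: complex)"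
      by (simp add: half_def field_simps)
    show ?thesis
      using \<omega>L_\<omega>Q [OF w, of "m + 1" "k + 1"] unfolding coeff
      by (simp add: bms_LQ_def incl_single mult.assoc rep.eval_const rep.eval_gen algebra_simps flip: w_def)
  qed
  have QQ: "rep (QB k) (rep (QB l) w) + rep (QB l) (rep (QB k) w) = rep.eval (incl (bms_br (QB k) (QB l)) * v)" for k l
  proof -
    \<comment> \<open>With r = k + 1/2 one has (k + 1) k = r^2 - 1/4.\<close>
    have coeff: "- 4 * \<rho>\<^sup>2 * (of_int (k + 1) * (of_int (k + 1) - 1)) = ((half k)\<^sup>2 - 1 / 4) / 3 * (- 12 * \<rho>\<^sup>2)"
      by (simp add: half_def power2_eq_square field_simps)
    show ?thesis
      using \<omega>Q_\<omega>Q [OF w, of "k + 1" "l + 1"] unfolding coeff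
      by (simp add: incl_add incl_single incl_zero distrib_right mult.assoc rep.eval_add
          rep.eval_const rep.eval_gen rep.eval_zero algebra_simps diff_divide_distrib flip: w_def)
  qed
  have LM': "rep (MB n) (rep (LB m) w) - rep (LB m) (rep (MB n) w) = - rep.eval (incl (vir MB C2B m n) * v)" for m n
    by (simp only: minus_diff_eq flip: LM)
  have LQ': "rep (QB k) (rep (LB m) w) - rep (LB m) (rep (QB k) w) = - rep.eval (incl (bms_LQ m k) * v)" for m k
    by (simp only: minus_diff_eq flip: LQ)
  have MM: "rep (MB m) (rep (MB n) w) = rep (MB n) (rep (MB m) w)" for m n
    using \<omega>M_\<omega>M [OF w] by simp
  have MQ: "rep (MB m) (rep (QB k) w) = rep (QB k) (rep (MB m) w)" for m k
    using \<omega>M_\<omega>Q [OF w] by simp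
  have rep_scale: "rep x (cscale k w) = cscale k (rep x w)" for x k
    using linear_map_onD(3) [OF linear_rep w] .
  have rep_minus: "rep x (- cscale k w) = - cscale k (rep x w)" for x k
    using rep_scale [of x "- k"] by simp
  \<comment> \<open>The operators of L, M, Q and the bracket of two Q stay folded, so that the facts
    above match; the cases with a central element reduce to linearity.\<close>
  have "rep x (rep y w) - cscale ((- 1) ^ (bms_par x * bms_par y)) (rep y (rep x w)) = rep.eval (incl (bms_br x y) * v)"
    by (cases x; cases y)
       (simp_all add: LL LM LM' LQ LQ' QQ MM MQ rep_scale rep_minus mult.commute incl_zero incl_minus rep.eval_zero rep.eval_minus
         del: rep.simps(1-3) bms_br.simps(4))
  then show ?thesis
    by (simp add: bracket)
qed

text \<open>By \<open>left_ideal_kernel\<close> only generators have to be checked. The one for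
  \<open>LB (- 1)\<close> goes to mode 0 of \<open>\<omega>L\<close> on the vacuum, which vanishes
  by creation.\<close>

lemma vac_ideal_kernel: "vac_ideal (5 / 2) (- 12 * \<rho>\<^sup>2) \<subseteq> {u. rep.eval u = 0}"
proof -
  have eval_gen: "rep.eval (gen x) = rep x vac_hc" for x
    using rep.eval_gen [of x 1] by (simp add: rep.eval_one)
  have eval_const: "rep.eval (const k) = cscale k vac_hc" for k
    using rep.eval_const [of k 1] by (simp add: rep.eval_one)
  have "rep.eval (gen x - const (bms_char (5 / 2) (- 12 * \<rho>\<^sup>2) x)) = 0" if "x \<in> bms_nonneg" for x
  proof -
    have "k \<ge> 0" if "(0 :: rat) < half k" for k
      using that by (cases "k \<ge> 0") (auto simp: half_def)
    then show ?thesis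
      using that by (auto simp: bms_nonneg_def rep.eval_diff eval_gen eval_const \<omega>_vac)
  qed
  then show ?thesis
    unfolding vac_ideal_def induced_ideal_def
    by (intro hull_minimal Un_least rep.left_ideal_kernel) (auto simp: eval_env_rel eval_gen \<omega>_vac)
qed

section \<open>The fields of the three states as normally ordered products\<close>

lemma Y_\<omega>L_normal_product:
  assumes w: "w \<in> M_hc"
  shows "Y \<omega>L n w = normal_product 0 a_op 0 b_op n w + cscale \<rho> (field_deriv a_op n w)
      + cscale (1 / 2) (normal_product 1 (field_deriv c_op) 1 c_op n w)"
proof -
  have "Y (a_op (- 1) b) n w = normal_product 0 a_op 0 b_op n w"
    using Y_minus_one_product [OF generator_degree(1,2) w, of n]
    by (simp add: w normal_product_def koszul_simps)
  moreover have "Y (c_op (- 2) c) n w = normal_product 1 (field_deriv c_op) 1 c_op n w"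
  proof -
    have c': "D c \<in> gr (3 / 2)"
      using hc_op_degree(3) [OF vac_degree, of "- 2"] by (simp add: D_generator half_def)
    \<comment> \<open>Reading the fermionic term as a product of index -1 with first factor
      \<open>D c\<close> produces the derivative of the field of \<open>c\<close>.\<close>
    have "c_op (- 2) c = Y (D c) (- 1) c"
      by (simp add: Y_D)
    then show ?thesis
      using Y_minus_one_product [OF c' generator_degree(3) w, of n]
      by (simp add: w normal_product_def koszul_simps field_deriv_def Y_D cscale.subspace_neg [OF subspace_V])
  qed
  ultimately show ?thesis
    unfolding \<omega>L_def by (simp add: w Y_add_left Y_scale_left Y_derivative field_deriv_def)
qed

lemma Y_\<omega>M_normal_product:
  assumes w: "w \<in> M_hc"
  shows "Y \<omega>M n w = cscale (1 / 2) (normal_product 0 b_op 0 b_op n w) + cscale \<rho> (field_deriv b_op n w)"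
proof -
  have "Y (b_op (- 1) b) n w = normal_product 0 b_op 0 b_op n w"
    using Y_minus_one_product [OF generator_degree(2,2) w, of n]
    by (simp add: w normal_product_def koszul_simps)
  then show ?thesis
    unfolding \<omega>M_def by (simp add: w Y_add_left Y_scale_left Y_derivative field_deriv_def)
qed

lemma Y_\<omega>Q_normal_product:
  assumes w: "w \<in> M_hc"
  shows "Y \<omega>Q n w = normal_product 0 b_op 1 c_op n w + cscale (2 * \<rho>) (field_deriv c_op n w)"
proof -
  have "Y (b_op (- 1) c) n w = normal_product 0 b_op 1 c_op n w"
    using Y_minus_one_product [OF generator_degree(2,3) w, of n]
    by (simp add: w normal_product_def koszul_simps)
  then show ?thesis
    unfolding \<omega>Q_def by (simp add: w Y_add_left Y_scale_left Y_derivative field_deriv_def)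
qed

end

section \<open>The free field realization\<close>

text \<open>The charge stays a symbol inside the module and its ideal; its value enters where the
  central element acts and where the ideal is compared with the kernel.\<close>

locale bms_realization = hc_vertex +
  fixes YV :: "bms falg cyc \<Rightarrow> int \<Rightarrow> bms falg cyc \<Rightarrow> bms falg cyc"
    and c2 :: complex
  assumes c2_eq: "c2 = - 12 * \<rho>\<^sup>2"
    and bms_vertex_superalgebra: "bms_vertex_superalgebra (5 / 2) c2 YV"
begin

abbreviation "V \<equiv> V_bms (5 / 2) c2"
abbreviation "vacV \<equiv> vac_bms (5 / 2) c2"
abbreviation "grV \<equiv> quot_grading bms_wt (vac_ideal (5 / 2) c2)"

sublocale V: vertex_superalgebra cscale V grV vacV "L_op (- 1)" YV
  using bms_vertex_superalgebra by (simp add: bms_vertex_superalgebra_def)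

section \<open>Homomorphisms are determined by the three states\<close>

abbreviation "hom \<equiv> vertex_hom cscale V vacV YV cscale M_hc vac_hc Y"

definition on_states :: "(bms falg cyc \<Rightarrow> hc falg cyc) \<Rightarrow> bool" where
  "on_states f \<longleftrightarrow>
    f (L_op (- 2) vacV) = \<omega>L \<and> f (M_op (- 2) vacV) = \<omega>M \<and> f (Q_op (- 2) vacV) = \<omega>Q"

lemma YV_generators:
  assumes "v \<in> V"
  shows "YV (L_op (- 2) vacV) n v = L_op (n - 1) v"
    and "YV (M_op (- 2) vacV) n v = M_op (n - 1) v"
    and "YV (Q_op (- 2) vacV) n v = Q_op (n - 1) v"
  using bms_vertex_superalgebra assms by (simp_all add: bms_vertex_superalgebra_def)

lemma bms_generator_degree:
  "L_op (- 2) vacV \<in> grV 2" "M_op (- 2) vacV \<in> grV 2" "Q_op (- 2) vacV \<in> grV (3 / 2)"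
  unfolding L_op_def M_op_def Q_op_def
  using act_gen_degree [OF V.vac_degree, of "LB (- 2)"] act_gen_degree [OF V.vac_degree, of "MB (- 2)"]
    act_gen_degree [OF V.vac_degree, of "QB (- 2)"]
  by (simp_all add: half_def)

lemmas bms_generator_in_V = bms_generator_degree [THEN V.gr_in_V]

text \<open>Every generator is a mode of one of the three generating states or a central element
  acting by a scalar.\<close>

lemma hom_act_gen:
  assumes f: "hom f" and states: "on_states f" and v: "v \<in> V"
  shows "f (act (gen x) v) = rep x (f v)"
proof -
  have lin: "linear_map_on cscale V cscale M_hc f"
    and YV: "\<And>u n. u \<in> V \<Longrightarrow> f (YV u n v) = Y (f u) n (f v)"
    using f v by (simp_all add: vertex_hom_def)
  show ?thesis
  proof (cases x)
    case (LB n)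
    then show ?thesis
      using YV [OF bms_generator_in_V(1), of "n + 1"] states
      by (simp add: YV_generators v on_states_def) (simp add: L_op_def)
  next
    case (MB n)
    then show ?thesis
      using YV [OF bms_generator_in_V(2), of "n + 1"] states
      by (simp add: YV_generators v on_states_def) (simp add: M_op_def)
  next
    case (QB n)
    then show ?thesis
      using YV [OF bms_generator_in_V(3), of "n + 1"] states
      by (simp add: YV_generators v on_states_def) (simp add: Q_op_def)
  qed (simp_all only: act_C1B [OF v] act_C2B [OF v] linear_map_onD(3) [OF lin v] rep.simps c2_eq)
qed

text \<open>The step offers a homogeneous \<open>v\<close>, since the Jacobi identity is available
  only for homogeneous states.\<close>

lemma V_induct [consumes 1, case_names zero add scale one gen]:
  assumes "v \<in> V" and "P 0"
    and "\<And>u v. u \<in> V \<Longrightarrow> v \<in> V \<Longrightarrow> P u \<Longrightarrow> P v \<Longrightarrow> P (u + v)"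
    and "\<And>k v. v \<in> V \<Longrightarrow> P v \<Longrightarrow> P (cscale k v)"
    and "P vacV"
    and "\<And>x v d. v \<in> grV d \<Longrightarrow> P v \<Longrightarrow> P (act (gen x) v)"
  shows "P v"
  using assms(1) unfolding V_bms_def
proof (induction v rule: quot_module_induct)
  case (gen x w)
  then show ?case using assms(6) [OF coset_word_degree] by blast
qed (use assms(2-5) in \<open>auto simp: V_bms_def vac_bms_def\<close>)

lemma hom_unique:
  assumes f: "hom f" "on_states f" and g: "hom g" "on_states g" and "v \<in> V"
  shows "f v = g v"
  using \<open>v \<in> V\<close>
proof (induction v rule: V_induct)
  case zero
  then show ?case
    using f(1) g(1) linear_map_on_0 [OF _ V.zero_in_V] unfolding vertex_hom_def by metis
next
  case (gen x v d)
  then show ?case by (simp add: hom_act_gen f g V.gr_in_V)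
qed (use f(1) g(1) in \<open>simp_all add: vertex_hom_def linear_map_on_def\<close>)

section \<open>Construction of the homomorphism\<close>

definition \<Phi> :: "bms falg cyc \<Rightarrow> hc falg cyc" where
  "\<Phi> = rep.descend (vac_ideal (5 / 2) c2)"

text \<open>Fixing the values outside \<open>V\<close> turns uniqueness on \<open>V\<close> into
  equality of functions.\<close>

lemma \<Phi>_extensional: "\<Phi> \<in> extensional V"
  by (simp add: \<Phi>_def rep.descend_def V_bms_def)

lemma linear_\<Phi>: "linear_map_on cscale V cscale M_hc \<Phi>"
  unfolding \<Phi>_def V_bms_def by (rule rep.linear_descend [OF bms.J vac_ideal_kernel [folded c2_eq]])

lemma \<Phi>_vac: "\<Phi> vacV = vac_hc"
  unfolding \<Phi>_def vac_bms_def by (rule rep.descend_one [OF bms.J vac_ideal_kernel [folded c2_eq]])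

lemma \<Phi>_act_gen: "v \<in> V \<Longrightarrow> \<Phi> (act (gen x) v) = rep x (\<Phi> v)"
  unfolding \<Phi>_def V_bms_def by (rule rep.descend_act_gen [OF bms.J vac_ideal_kernel [folded c2_eq]])

text \<open>The operators of index -2, and of index -3/2 for Q, act as mode -1 of the corresponding
  states, and mode -1 on the vacuum returns the state.\<close>

lemma on_states_\<Phi>: "on_states \<Phi>"
  unfolding on_states_def L_op_def M_op_def Q_op_def
  by (simp add: \<Phi>_act_gen V.vac_in_V \<Phi>_vac creation(2))

lemma \<Phi>_generator_modes:
  assumes "v \<in> V"
  shows "\<Phi> (YV (L_op (- 2) vacV) n v) = Y (\<Phi> (L_op (- 2) vacV)) n (\<Phi> v)"
    and "\<Phi> (YV (M_op (- 2) vacV) n v) = Y (\<Phi> (M_op (- 2) vacV)) n (\<Phi> v)"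
    and "\<Phi> (YV (Q_op (- 2) vacV) n v) = Y (\<Phi> (Q_op (- 2) vacV)) n (\<Phi> v)"
proof -
  have "\<Phi> (L_op (n - 1) v) = Y \<omega>L n (\<Phi> v)" "\<Phi> (M_op (n - 1) v) = Y \<omega>M n (\<Phi> v)"
    "\<Phi> (Q_op (n - 1) v) = Y \<omega>Q n (\<Phi> v)"
    unfolding L_op_def M_op_def Q_op_def by (simp_all add: \<Phi>_act_gen assms)
  then show "\<Phi> (YV (L_op (- 2) vacV) n v) = Y (\<Phi> (L_op (- 2) vacV)) n (\<Phi> v)"
    and "\<Phi> (YV (M_op (- 2) vacV) n v) = Y (\<Phi> (M_op (- 2) vacV)) n (\<Phi> v)"
    and "\<Phi> (YV (Q_op (- 2) vacV) n v) = Y (\<Phi> (Q_op (- 2) vacV)) n (\<Phi> v)"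
    using on_states_\<Phi> by (simp_all add: YV_generators assms on_states_def)
qed

lemma \<Phi>_degree:
  assumes "v \<in> grV d"
  shows "\<Phi> v \<in> gr d"
proof -
  have word: "\<Phi> (coset (vac_ideal (5 / 2) c2) (Poly_Mapping.single w 1)) \<in> gr (sum_list (map bms_wt w))" for w
  proof (induction w)
    case Nil
    then show ?case
      using \<Phi>_vac vac_degree const_1 [where 'a = bms] by (simp add: const_def vac_bms_def)
  next
    case (Cons x w)
    have "coset (vac_ideal (5 / 2) c2) (Poly_Mapping.single w 1) \<in> V"
      by (simp add: V_bms_def quot_module_def)
    from \<Phi>_act_gen [OF this, of x] rep_degree [OF Cons, of x] show ?case
      by (simp add: single_Cons act_coset)
  qed
  obtain u where u: "v = coset (vac_ideal (5 / 2) c2) u"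
      "\<And>w. w \<in> Poly_Mapping.keys u \<Longrightarrow> sum_list (map bms_wt w) = d"
    using assms by (auto simp: quot_grading_def)
  have "\<Phi> v = rep.eval u"
    unfolding \<Phi>_def u(1) by (rule rep.descend_coset [OF bms.J vac_ideal_kernel [folded c2_eq]])
  also have "\<dots> = (\<Sum>w\<in>Poly_Mapping.keys u. cscale (Poly_Mapping.lookup u w) (foldr rep w vac_hc))"
    by (simp add: free_eval_def)
  also have "\<dots> \<in> gr d"
  proof (intro cscale.subspace_sum [OF subspace_gr] cscale.subspace_scale [OF subspace_gr])
    fix w assume "w \<in> Poly_Mapping.keys u"
    moreover have "foldr rep w vac_hc \<in> gr (sum_list (map bms_wt w))"
      by (induction w) (simp_all add: vac_degree rep_degree)
    ultimately show "foldr rep w vac_hc \<in> gr d" using u(2) by metis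
  qed
  finally show ?thesis .
qed

text \<open>Induction runs over \<open>u\<close> alone, with \<open>v\<close> and \<open>n\<close>
  arbitrary: applying a generator to \<open>u\<close> is taking a product with a generating state,
  or scaling if the generator is central, so \<open>intertwines_product\<close> carries the
  step.\<close>

lemma \<Phi>_hom: "hom \<Phi>"
proof -
  note product = intertwines_product [OF V.vertex_superalgebra_axioms vertex_superalgebra_axioms linear_\<Phi>]
    and lin = linear_map_onD [OF linear_\<Phi>]
  have "\<forall>n. \<forall>v\<in>V. \<Phi> (YV u n v) = Y (\<Phi> u) n (\<Phi> v)" if "u \<in> V" for u
    using that
  proof (induction u rule: V_induct)
    case zero
    then show ?case
      by (simp add: V.Y_zero_left Y_zero_left lin(1) linear_map_on_0 [OF linear_\<Phi> V.zero_in_V])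
  next
    case (add u v)
    then show ?case
      by (simp add: V.Y_add_left Y_add_left lin V.Y_in_V)
  next
    case (scale k v)
    then show ?case
      by (simp add: V.Y_scale_left Y_scale_left lin V.Y_in_V)
  next
    case one
    then show ?case
      by (simp add: V.vacuum vacuum \<Phi>_vac lin(1) linear_map_on_0 [OF linear_\<Phi> V.zero_in_V])
  next
    case (gen x v d)
    then have v: "v \<in> V" "\<Phi> v \<in> gr d" and IH: "\<And>n w. w \<in> V \<Longrightarrow> \<Phi> (YV v n w) = Y (\<Phi> v) n (\<Phi> w)"
      using V.gr_in_V \<Phi>_degree by auto
    note gens = bms_generator_degree [THEN \<Phi>_degree]
    show ?case
    proof (cases x)
      case (LB k)
      have "act (gen x) v = YV (L_op (- 2) vacV) (k + 1) v"
        by (simp add: LB YV_generators v) (simp add: L_op_def)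
      then show ?thesis
        using product [OF bms_generator_degree(1) gens(1) gen(1) v(2) \<Phi>_generator_modes(1) IH] by simp
    next
      case (MB k)
      have "act (gen x) v = YV (M_op (- 2) vacV) (k + 1) v"
        by (simp add: MB YV_generators v) (simp add: M_op_def)
      then show ?thesis
        using product [OF bms_generator_degree(2) gens(2) gen(1) v(2) \<Phi>_generator_modes(2) IH] by simp
    next
      case (QB k)
      have "act (gen x) v = YV (Q_op (- 2) vacV) (k + 1) v"
        by (simp add: QB YV_generators v) (simp add: Q_op_def)
      then show ?thesis
        using product [OF bms_generator_degree(3) gens(3) gen(1) v(2) \<Phi>_generator_modes(3) IH] by simp
    qed (simp_all add: act_C1B [OF v(1)] act_C2B [OF v(1)] V.Y_scale_left Y_scale_left lin V.Y_in_V v(1) IH)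
  qed
  then show ?thesis
    by (simp add: vertex_hom_def linear_\<Phi> \<Phi>_vac)
qed

end

theorem proposition5p6:
  fixes \<rho> :: complex
    and YV :: "bms falg cyc \<Rightarrow> int \<Rightarrow> bms falg cyc \<Rightarrow> bms falg cyc"
    and DM :: "hc falg cyc \<Rightarrow> hc falg cyc"
    and YM :: "hc falg cyc \<Rightarrow> int \<Rightarrow> hc falg cyc \<Rightarrow> hc falg cyc"
  defines "V \<equiv> V_bms (5 / 2) (- 12 * \<rho>\<^sup>2)"
    and "vacV \<equiv> vac_bms (5 / 2) (- 12 * \<rho>\<^sup>2)"
    and "a \<equiv> a_op (- 1) vac_hc"
    and "b \<equiv> b_op (- 1) vac_hc"
    and "c \<equiv> c_op (- 1) vac_hc"
  defines "is_hom \<equiv> \<lambda>\<Phi>. \<Phi> \<in> extensional V \<and> vertex_hom cscale V vacV YV cscale M_hc vac_hc YM \<Phi>"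
    and "on_states \<equiv> \<lambda>\<Phi>.
      \<Phi> (L_op (- 2) vacV) =
        a_op (- 1) b + cscale \<rho> (a_op (- 2) vac_hc) + cscale (1 / 2) (c_op (- 2) c) \<and>
      \<Phi> (M_op (- 2) vacV) = cscale (1 / 2) (b_op (- 1) b) + cscale \<rho> (b_op (- 2) vac_hc) \<and>
      \<Phi> (Q_op (- 2) vacV) = b_op (- 1) c + cscale (2 * \<rho>) (c_op (- 2) vac_hc)"
    and "on_fields \<equiv> \<lambda>\<Phi>. \<forall>n. \<forall>w\<in>M_hc.
      YM (\<Phi> (L_op (- 2) vacV)) n w =
        normal_product 0 a_op 0 b_op n w + cscale \<rho> (field_deriv a_op n w)
        + cscale (1 / 2) (normal_product 1 (field_deriv c_op) 1 c_op n w) \<and>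
      YM (\<Phi> (M_op (- 2) vacV)) n w =
        cscale (1 / 2) (normal_product 0 b_op 0 b_op n w) + cscale \<rho> (field_deriv b_op n w) \<and>
      YM (\<Phi> (Q_op (- 2) vacV)) n w =
        normal_product 0 b_op 1 c_op n w + cscale (2 * \<rho>) (field_deriv c_op n w)"
  assumes "bms_vertex_superalgebra (5 / 2) (- 12 * \<rho>\<^sup>2) YV"
    and "hc_vertex_superalgebra DM YM"
  shows "(\<exists>!\<Phi>. is_hom \<Phi> \<and> on_states \<Phi>) \<and> (\<forall>\<Phi>. is_hom \<Phi> \<longrightarrow> (on_states \<Phi> \<longleftrightarrow> on_fields \<Phi>))"
proof -
  interpret R: bms_realization DM YM \<rho> YV "- 12 * \<rho>\<^sup>2"
    using assms(9,10) by unfold_locales simp_all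
  have on_states: "on_states f \<longleftrightarrow> R.on_states f" for f
    unfolding assms(2-5,7) R.on_states_def R.\<omega>L_def R.\<omega>M_def R.\<omega>Q_def ..
  have is_hom: "is_hom f \<longleftrightarrow> f \<in> extensional V \<and> R.hom f" for f
    unfolding assms(1,2,6) ..
  \<comment> \<open>By the normal product lemmas the second form says that the images have the same
    fields as the three states.\<close>
  have on_fields: "on_fields f \<longleftrightarrow> (\<forall>n. \<forall>w\<in>M_hc. YM (f (L_op (- 2) vacV)) n w = YM R.\<omega>L n w \<and>
      YM (f (M_op (- 2) vacV)) n w = YM R.\<omega>M n w \<and> YM (f (Q_op (- 2) vacV)) n w = YM R.\<omega>Q n w)" for f
    unfolding assms(8)
    by (simp add: R.Y_\<omega>L_normal_product R.Y_\<omega>M_normal_product R.Y_\<omega>Q_normal_product)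
  \<comment> \<open>By creation, mode -1 on the vacuum recovers a state from its field.\<close>
  have state_field: "f u = x" if "R.hom f" "u \<in> V" "x \<in> M_hc" "YM (f u) (- 1) vac_hc = YM x (- 1) vac_hc" for f u x
    using that R.creation(2) linear_map_onD(1) unfolding vertex_hom_def assms(1) by metis
  have "on_states f \<longleftrightarrow> on_fields f" if "is_hom f" for f
  proof
    show "on_fields f" if "on_states f"
      using that unfolding on_fields on_states R.on_states_def assms(2) by simp
    show "on_states f" if "on_fields f"
    proof -
      have "YM (f (L_op (- 2) vacV)) (- 1) vac_hc = YM R.\<omega>L (- 1) vac_hc"
        "YM (f (M_op (- 2) vacV)) (- 1) vac_hc = YM R.\<omega>M (- 1) vac_hc"
        "YM (f (Q_op (- 2) vacV)) (- 1) vac_hc = YM R.\<omega>Q (- 1) vac_hc"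
        using that R.vac_in_V unfolding on_fields by blast+
      then show ?thesis
        using \<open>is_hom f\<close> R.bms_generator_in_V R.in_M(10-12)
        unfolding on_states R.on_states_def is_hom assms(1,2) by (auto intro!: state_field simp: assms(1))
    qed
  qed
  moreover have "\<exists>!\<Phi>. is_hom \<Phi> \<and> on_states \<Phi>"
  proof (rule ex1I [of _ R.\<Phi>])
    show "is_hom R.\<Phi> \<and> on_states R.\<Phi>"
      unfolding is_hom on_states assms(1) using R.\<Phi>_extensional R.\<Phi>_hom R.on_states_\<Phi> by blast
    show "f = R.\<Phi>" if "is_hom f \<and> on_states f" for f
      using that R.\<Phi>_extensional R.\<Phi>_hom R.on_states_\<Phi> R.hom_unique unfolding is_hom on_states assms(1)
      by (intro extensionalityI) blast+
  qed
  ultimately show ?thesis by blast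
qed

end
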